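(* Let $\{x(u,t)\}_{u\in\mathbb{R},t\ge 0}$ be the stochastic flow generated by the equation $x(u,t)=u+\int_0^t\int_{\mathbb{R}}\varphi(x(u,s)-q)\,W(dq,ds)$, with $\varphi$ and $W$ as in the context. Then: for all $n\ge1$ and all $u_1,\dots,u_{2n-1}\in\mathbb{R}$, $$\lim_{t\to+\infty}\frac{1}{t^{n-\frac12}}\,\mathbf{E}\,[x(u_1,t)\cdots x(u_{2n-1},t)]=0;$$ for all $n\ge1$ and all $u_1,\dots,u_{2n}\in\mathbb{R}$, $$\lim_{t\to+\infty}\frac{1}{t^{n}}\,\mathbf{E}\,[x(u_1,t)\cdots x(u_{2n},t)]=(2n-1)!!.$$
   Context: Let $W$ be a Wiener sheet on $\mathbb{R}\times\mathbb{R}_+$ (Gaussian white noise with Lebesgue control measure, the second coordinate being time), and let $\varphi\in C^\infty(\mathbb{R})$ be a compactly supported, non-negative, even function with $\int_{\mathbb{R}}\varphi^2(q)\,dq=1$. For every $u\in\mathbb{R}$ the stochastic integral equation $$x(u,t)=u+\int_0^t\int_{\mathbb{R}}\varphi(x(u,s)-q)\,W(dq,ds),\quad t\ge 0,$$ has a unique solution, and the random maps $x(\cdot,t):\mathbb{R}\to\mathbb{R}$, $t\ge0$, form an isotropic Brownian stochastic flow of $C^\infty$-diffeomorphisms (with probability one, for all $t\geq 0$, $x(\cdot,t)$ is a strictly increasing $C^\infty$-diffeomorphism, and $x(u,t)$ is jointly continuous in $(u,t)$). The double factorial $(2n-1)!!$ is $1\cdot3\cdots(2n-1)$. *)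

theory Defs
  imports "HOL-Probability.Probability"
begin

section \<open>Gaussian white noise on \<open>\<real> \<times> \<real>\<^sub>+\<close>\<close>

text \<open>Points are pairs \<open>(q, s)\<close> of a space coordinate and a time coordinate.\<close>

definition noise_sets :: "(real \<times> real) set set" where
  "noise_sets = {A \<in> sets borel. A \<subseteq> UNIV \<times> {0..} \<and> emeasure lborel A < \<infinity>}"

text \<open>Point masses count as Gaussian laws of variance \<open>0\<close>; this has to be said separately,
  since \<^term>\<open>normal_density m 0\<close> is identically \<open>0\<close>.\<close>

definition gaussian_law :: "real \<Rightarrow> real \<Rightarrow> real measure" where
  "gaussian_law m \<sigma> =
     (if \<sigma> = 0 then return borel m else density lborel (\<lambda>y. ennreal (normal_density m \<sigma> y)))"

definition gaussian_rv :: "'a measure \<Rightarrow> ('a \<Rightarrow> real) \<Rightarrow> bool" where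
  "gaussian_rv M X \<longleftrightarrow>
     X \<in> borel_measurable M \<and> (\<exists>m \<sigma>. \<sigma> \<ge> 0 \<and> distr M borel X = gaussian_law m \<sigma>)"

text \<open>A centred, jointly Gaussian family with covariance \<open>E[W(A) W(B)] = |A \<inter> B|\<close>. The Wiener
  sheet itself is recovered as the noise of the rectangles with a corner at the origin.\<close>

definition white_noise :: "'a measure \<Rightarrow> ((real \<times> real) set \<Rightarrow> 'a \<Rightarrow> real) \<Rightarrow> bool" where
  "white_noise M W \<longleftrightarrow>
     (\<forall>\<A> c. finite \<A> \<and> \<A> \<subseteq> noise_sets \<longrightarrow> gaussian_rv M (\<lambda>\<omega>. \<Sum>A\<in>\<A>. c A * W A \<omega>)) \<and>
     (\<forall>A\<in>noise_sets. (\<integral>\<omega>. W A \<omega> \<partial>M) = 0) \<and>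
     (\<forall>A\<in>noise_sets. \<forall>B\<in>noise_sets.
        (\<integral>\<omega>. W A \<omega> * W B \<omega> \<partial>M) = measure lborel (A \<inter> B))"

text \<open>A filtration to which the noise is adapted and whose past is independent of the future
  noise. The natural filtration of the noise, completed or not, is an example. Negative time
  indices play no role.\<close>

definition noise_filtration ::
  "'a measure \<Rightarrow> ((real \<times> real) set \<Rightarrow> 'a \<Rightarrow> real) \<Rightarrow> (real \<Rightarrow> 'a measure) \<Rightarrow> bool" where
  "noise_filtration M W F \<longleftrightarrow>
     filtration (space M) F \<and>
     (\<forall>t. subalgebra M (F t)) \<and>
     (\<forall>t\<ge>0. \<forall>A\<in>noise_sets. A \<subseteq> UNIV \<times> {..t} \<longrightarrow> W A \<in> borel_measurable (F t)) \<and>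
     (\<forall>t\<ge>0. prob_space.indep_set M (sets (F t))
        (sigma_sets (space M)
          {W A -` B \<inter> space M | A B. A \<in> noise_sets \<and> A \<subseteq> UNIV \<times> {t<..} \<and> B \<in> sets borel}))"

section \<open>The stochastic integral\<close>

text \<open>A list of quadruples \<open>(X, a, b, A)\<close> stands for the elementary integrand
  \<open>\<Sum> X(\<omega>) 1\<^bsub>A\<^esub>(q) 1\<^bsub>(a, b]\<^esub>(s)\<close>.\<close>

type_synonym 'a elementary = "(('a \<Rightarrow> real) \<times> real \<times> real \<times> real set) list"

definition elementary :: "(real \<Rightarrow> 'a measure) \<Rightarrow> 'a elementary \<Rightarrow> bool" where
  "elementary F S \<longleftrightarrow>
     (\<forall>(X, a, b, A) \<in> set S.
        0 \<le> a \<and> a \<le> b \<and> A \<in> sets borel \<and> emeasure lborel A < \<infinity> \<and>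
        X \<in> borel_measurable (F a) \<and> (\<exists>C. \<forall>\<omega>\<in>space (F a). \<bar>X \<omega>\<bar> \<le> C))"

definition elem_val :: "'a elementary \<Rightarrow> 'a \<times> real \<times> real \<Rightarrow> real" where
  "elem_val S = (\<lambda>(\<omega>, q, s).
     (\<Sum>(X, a, b, A) \<leftarrow> S. X \<omega> * indicator A q * indicator {a<..b} s))"

definition elem_integral ::
  "((real \<times> real) set \<Rightarrow> 'a \<Rightarrow> real) \<Rightarrow> real \<Rightarrow> 'a elementary \<Rightarrow> 'a \<Rightarrow> real" where
  "elem_integral W t S \<omega> = (\<Sum>(X, a, b, A) \<leftarrow> S. X \<omega> * W (A \<times> ({a<..b} \<inter> {..t})) \<omega>)"

text \<open>\<open>has_stochastic_integral M F W t f I\<close>: the random variable \<open>I\<close> is (a version of) the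
  Ito--Walsh integral of \<open>f(\<omega>, q, s)\<close> against \<open>W(dq, ds)\<close> over \<open>\<real> \<times> [0, t]\<close>, that is, the
  \<open>L\<^sup>2\<close>-limit of the integrals of elementary integrands converging to \<open>f\<close> in \<open>L\<^sup>2\<close>.
  The measurability of \<open>f\<close> and \<open>I\<close> is indispensable here, as \<^term>\<open>nn_integral\<close> is only a lower
  integral for non-measurable functions.\<close>

definition has_stochastic_integral ::
  "'a measure \<Rightarrow> (real \<Rightarrow> 'a measure) \<Rightarrow> ((real \<times> real) set \<Rightarrow> 'a \<Rightarrow> real) \<Rightarrow> real \<Rightarrow>
     ('a \<times> real \<times> real \<Rightarrow> real) \<Rightarrow> ('a \<Rightarrow> real) \<Rightarrow> bool" where
  "has_stochastic_integral M F W t f I \<longleftrightarrow>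
     (let N = M \<Otimes>\<^sub>M restrict_space lborel (UNIV \<times> {0..t}) in
       f \<in> borel_measurable N \<and> I \<in> borel_measurable M \<and>
       (\<exists>S :: nat \<Rightarrow> 'a elementary.
          (\<forall>k. elementary F (S k)) \<and>
          (\<lambda>k. \<integral>\<^sup>+p. ennreal ((elem_val (S k) p - f p)\<^sup>2) \<partial>N) \<longlonglongrightarrow> 0 \<and>
          (\<lambda>k. \<integral>\<^sup>+\<omega>. ennreal ((elem_integral W t (S k) \<omega> - I \<omega>)\<^sup>2) \<partial>M) \<longlonglongrightarrow> 0))"

section \<open>The flow\<close>

definition smooth :: "(real \<Rightarrow> real) \<Rightarrow> bool" where
  "smooth f \<longleftrightarrow> (\<forall>n y. (deriv ^^ n) f field_differentiable at y)"

definition increasing_diffeo :: "(real \<Rightarrow> real) \<Rightarrow> bool" where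
  "increasing_diffeo f \<longleftrightarrow> strict_mono f \<and> bij f \<and> smooth f \<and> smooth (inv f)"

text \<open>\<open>x u t \<omega>\<close> is the position at time \<open>t\<close> of the particle started at \<open>u\<close>. For each \<open>u\<close> the
  equation is required almost surely at every time; the last two clauses select the version of the
  family of solutions that is a flow of diffeomorphisms.\<close>

definition stochastic_flow ::
  "'a measure \<Rightarrow> (real \<Rightarrow> 'a measure) \<Rightarrow> ((real \<times> real) set \<Rightarrow> 'a \<Rightarrow> real) \<Rightarrow>
     (real \<Rightarrow> real) \<Rightarrow> (real \<Rightarrow> real \<Rightarrow> 'a \<Rightarrow> real) \<Rightarrow> bool" where
  "stochastic_flow M F W \<phi> x \<longleftrightarrow>
     (\<forall>u. \<forall>t\<ge>0. x u t \<in> borel_measurable (F t)) \<and>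
     (\<forall>u. \<forall>t\<ge>0. \<exists>I.
        has_stochastic_integral M F W t (\<lambda>(\<omega>, q, s). \<phi> (x u s \<omega> - q)) I \<and>
        (AE \<omega> in M. x u t \<omega> = u + I \<omega>)) \<and>
     (AE \<omega> in M. continuous_on (UNIV \<times> {0..}) (\<lambda>(u, t). x u t \<omega>)) \<and>
     (AE \<omega> in M. \<forall>t\<ge>0. increasing_diffeo (\<lambda>u. x u t \<omega>))"

end

theory Submission
  imports Defs
begin

text \<open>Each \<open>x u t - u\<close> is a stochastic integral whose integrand has quadratic variation exactly \<open>t\<close>,
  hence it is normal with variance \<open>t\<close>. As particles keep their order,
  \<open>E \<bar>x u t - x v t\<bar> = \<bar>u - v\<bar>\<close> stays bounded, so on the scale \<open>sqrt t\<close> all particles coincide and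
  the normalized product converges in mean to a power of a single standard normal variable.

  Normality is seen on characteristic functions. For an elementary integrand with integral \<open>X\<close> and
  quadratic variation \<open>Q\<close>, freezing the past at each endpoint gives
  \<open>\<bar>E (exp (i l X)) - exp (- l\<^sup>2 t / 2)\<bar> \<le> (l\<^sup>2 / 2) E \<bar>Q - t\<bar>\<close>, which passes to the
  \<open>L\<^sup>2\<close> limit.\<close>

section \<open>Centred normal variables\<close>

text \<open>The integral is known only as an L2 limit, so normality has to be read off a quantity
  that is stable under such limits. The obstacle is that only the limiting integrand has quadratic
  variation t: that of an approximant is random and close to t merely in L1, so the exponential
  martingale exp (i l X + l^2 Q / 2) has no bound uniform in the approximation. Stopping the
  compensator at level t keeps everything in the unit disc. The excess of Q over t then costs the
  martingale property, the deficit is paid when the remaining damping is removed at the end, and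
  together they make up the mean of |Q - t|.

  That Q = t holds path by path reflects homogeneity: at a fixed time the integral of phi^2 over
  space does not see where the particle is. The joint law of several particles is never computed; L1
  closeness of the particles is combined with moment bounds that use the one-particle laws
  alone.\<close>

lemma prob_space_std_normal: "prob_space std_normal_distribution"
  using real_dist_normal_dist by (simp add: real_distribution_def)

text \<open>Both branches of \<open>gaussian_law\<close> become one affine image, so later proofs
  need not separate the degenerate case, which has no density.\<close>

lemma gaussian_law_eq_distr:
  assumes "\<sigma> \<ge> 0"
  shows "gaussian_law m \<sigma> = distr std_normal_distribution borel (\<lambda>z. m + \<sigma> * z)"
proof (cases "\<sigma> = 0")
  case True
  interpret prob_space std_normal_distribution by (rule prob_space_std_normal)
  show ?thesis using True
    by (auto simp: gaussian_law_def intro!: measure_eqI simp: emeasure_distr emeasure_space_1 indicator_def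
        vimage_def)
next
  case False
  with assms have "\<sigma> > 0" by simp
  interpret prob_space std_normal_distribution by (rule prob_space_std_normal)
  have "distributed std_normal_distribution lborel (\<lambda>x. x) std_normal_density"
    by (auto simp: distributed_def intro!: measure_eqI simp: emeasure_distr)
  from normal_density_affine[OF this _ False, of m] 
  have "distributed std_normal_distribution lborel (\<lambda>x. m + \<sigma> * x) (normal_density m \<sigma>)"
    using \<open>\<sigma> > 0\<close> by simp
  then show ?thesis
    using False by (auto simp: gaussian_law_def distributed_def cong: distr_cong)
qed

locale scaled_normal =
  fixes M :: "'a measure" and X :: "'a \<Rightarrow> real" and \<sigma> :: real
  assumes measurable_X [measurable]: "X \<in> borel_measurable M"
    and distr_X: "distr M borel X = distr std_normal_distribution borel (\<lambda>z. \<sigma> * z)"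
begin

lemma integrable_power: "integrable M (\<lambda>\<omega>. X \<omega> ^ k)"
proof -
  have "integrable (distr M borel X) (\<lambda>z. z ^ k)"
    unfolding distr_X by (subst integrable_distr_eq)
      (auto simp: power_mult_distrib integrable_std_normal_distribution_moment)
  then show ?thesis by (subst (asm) integrable_distr_eq) auto
qed

lemma integral_power: "(\<integral>\<omega>. X \<omega> ^ k \<partial>M) = \<sigma> ^ k * (\<integral>z. z ^ k \<partial>std_normal_distribution)"
proof -
  have "(\<integral>\<omega>. X \<omega> ^ k \<partial>M) = (\<integral>z. z ^ k \<partial>distr M borel X)"
    by (subst integral_distr) auto
  also have "\<dots> = (\<integral>z. (\<sigma> * z) ^ k \<partial>std_normal_distribution)"
    unfolding distr_X by (subst integral_distr) auto
  finally show ?thesis by (simp add: power_mult_distrib)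
qed

lemma integral_X: "(\<integral>\<omega>. X \<omega> \<partial>M) = 0"
  using integral_power[of 1] integral_std_normal_distribution_moment_odd[of 1] by simp

lemma integral_X_square: "(\<integral>\<omega>. (X \<omega>)\<^sup>2 \<partial>M) = \<sigma>\<^sup>2"
  using integral_power[of 2] std_normal_distribution_even_moments(1)[of 1] by simp

lemma integral_iexp: "(CLINT \<omega>|M. iexp (t * X \<omega>)) = complex_of_real (exp (- (t\<^sup>2 * \<sigma>\<^sup>2) / 2))"
proof -
  have "(CLINT \<omega>|M. iexp (t * X \<omega>)) = (CLINT z|distr M borel X. iexp (t * z))"
    by (subst integral_distr) auto
  also have "\<dots> = (CLINT z|std_normal_distribution. iexp (t * (\<sigma> * z)))"
    unfolding distr_X by (subst integral_distr) auto
  also have "\<dots> = char std_normal_distribution (t * \<sigma>)"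
    by (simp add: char_def mult.assoc)
  finally show ?thesis by (simp add: char_std_normal_distribution power_mult_distrib)
qed

end

text \<open>A Gaussian variable is integrable, so the second hypothesis concerns the true mean
  \<open>m\<close> and cannot hold through the default value 0 of a non-integrable function.\<close>

lemma gaussian_rv_scaled_normal:
  assumes "gaussian_rv M X" "(\<integral>\<omega>. X \<omega> \<partial>M) = 0"
  obtains \<sigma> where "\<sigma> \<ge> 0" "scaled_normal M X \<sigma>"
proof -
  interpret N: prob_space std_normal_distribution by (rule prob_space_std_normal)
  from assms(1) obtain m \<sigma> where X [measurable]: "X \<in> borel_measurable M" and "\<sigma> \<ge> 0"
    and d: "distr M borel X = gaussian_law m \<sigma>" by (auto simp: gaussian_rv_def)
  have "(\<integral>\<omega>. X \<omega> \<partial>M) = (\<integral>z. z \<partial>distr M borel X)"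
    by (subst integral_distr) auto
  also have "\<dots> = (\<integral>z. m + \<sigma> * z \<partial>std_normal_distribution)"
    unfolding d gaussian_law_eq_distr[OF \<open>\<sigma> \<ge> 0\<close>] by (subst integral_distr) auto
  also have "\<dots> = m"
    using integrable_std_normal_distribution_moment[of 1] N.prob_space
      integral_std_normal_distribution_moment_odd[of 1] by simp
  finally have "m = 0" using assms(2) by simp
  then show thesis
    using that[of \<sigma>] \<open>\<sigma> \<ge> 0\<close> X d gaussian_law_eq_distr[OF \<open>\<sigma> \<ge> 0\<close>] by (simp add: scaled_normal_def)
qed

text \<open>By Levy's uniqueness theorem the characteristic function determines the law; this is how
  the limit integral is recognised as normal.\<close>

lemma scaled_normalI:
  assumes "prob_space M" and X [measurable]: "X \<in> borel_measurable M"
    and char: "\<And>t. (CLINT \<omega>|M. iexp (t * X \<omega>)) = complex_of_real (exp (- (t\<^sup>2 * \<sigma>\<^sup>2) / 2))"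
  shows "scaled_normal M X \<sigma>"
proof -
  interpret prob_space M by fact
  interpret N: prob_space std_normal_distribution by (rule prob_space_std_normal)
  have "distr M borel X = distr std_normal_distribution borel (\<lambda>z. \<sigma> * z)"
  proof (rule Levy_uniqueness)
    show "real_distribution (distr M borel X)" by simp
    show "real_distribution (distr std_normal_distribution borel (\<lambda>z. \<sigma> * z))" by simp
    have "char (distr M borel X) t = char (distr std_normal_distribution borel (\<lambda>z. \<sigma> * z)) t" for t
    proof -
      have "scaled_normal std_normal_distribution (\<lambda>z. \<sigma> * z) \<sigma>"
        by (simp add: scaled_normal_def)
      from scaled_normal.integral_iexp[OF this, of t] char[of t] show ?thesis
        by (simp add: char_def integral_distr)
    qed
    then show "char (distr M borel X) = char (distr std_normal_distribution borel (\<lambda>z. \<sigma> * z))" by blast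
  qed
  then show ?thesis by (simp add: scaled_normal_def)
qed

section \<open>White noise\<close>

locale white_noise_space = prob_space M
  for M :: "'a measure" +
  fixes F :: "real \<Rightarrow> 'a measure" and W :: "(real \<times> real) set \<Rightarrow> 'a \<Rightarrow> real"
  assumes white_noise: "white_noise M W" and noise_filtration: "noise_filtration M W F"
begin

lemma gaussian_W: "A \<in> noise_sets \<Longrightarrow> gaussian_rv M (W A)"
  using white_noise[unfolded white_noise_def, THEN conjunct1, rule_format, of "{A}" "\<lambda>_. 1"]
  by simp

lemma measurable_W [measurable]: "A \<in> noise_sets \<Longrightarrow> W A \<in> borel_measurable M"
  using gaussian_W by (simp add: gaussian_rv_def)

lemma scaled_normal_W:
  assumes "A \<in> noise_sets" obtains \<sigma> where "\<sigma> \<ge> 0" "scaled_normal M (W A) \<sigma>"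
  using assms gaussian_rv_scaled_normal[OF gaussian_W] white_noise by (auto simp: white_noise_def)

lemma integrable_W: "A \<in> noise_sets \<Longrightarrow> integrable M (W A)"
  using scaled_normal_W[of A] scaled_normal.integrable_power[of M "W A" _ 1] by auto

lemma integrable_W_W:
  assumes "A \<in> noise_sets" "B \<in> noise_sets"
  shows "integrable M (\<lambda>\<omega>. W A \<omega> * W B \<omega>)"
proof (rule Bochner_Integration.integrable_bound)
  have "integrable M (\<lambda>\<omega>. (W A \<omega>)\<^sup>2)" if "A \<in> noise_sets" for A
    using scaled_normal_W[OF that] scaled_normal.integrable_power[of M "W A" _ 2] by auto
  then show "integrable M (\<lambda>\<omega>. (W A \<omega>)\<^sup>2 + (W B \<omega>)\<^sup>2)" using assms by auto
  show "(\<lambda>\<omega>. W A \<omega> * W B \<omega>) \<in> borel_measurable M" using assms by measurable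
  have "\<bar>a * b\<bar> \<le> a\<^sup>2 + b\<^sup>2" for a b :: real
    by (rule power2_le_imp_le) 
       (auto simp: power_mult_distrib power2_eq_square[of "_ + _"] algebra_simps add_increasing)
  then show "AE \<omega> in M. norm (W A \<omega> * W B \<omega>) \<le> norm ((W A \<omega>)\<^sup>2 + (W B \<omega>)\<^sup>2)"
    by auto
qed

lemma integral_W_W:
  "A \<in> noise_sets \<Longrightarrow> B \<in> noise_sets \<Longrightarrow> (\<integral>\<omega>. W A \<omega> * W B \<omega> \<partial>M) = measure lborel (A \<inter> B)"
  using white_noise by (auto simp: white_noise_def)

lemma integral_sum_W:
  assumes "finite J" "\<And>j. j \<in> J \<Longrightarrow> B j \<in> noise_sets"
  shows "(\<integral>\<omega>. (\<Sum>j\<in>J. c j * W (B j) \<omega>) \<partial>M) = 0"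
proof -
  have "(\<integral>\<omega>. (\<Sum>j\<in>J. c j * W (B j) \<omega>) \<partial>M) = (\<Sum>j\<in>J. c j * (\<integral>\<omega>. W (B j) \<omega> \<partial>M))"
    using assms by (simp add: integrable_W)
  also have "\<dots> = 0"
    using assms white_noise by (intro sum.neutral) (auto simp: white_noise_def)
  finally show ?thesis .
qed

lemma integral_sum_W_square:
  assumes "finite J" "\<And>j. j \<in> J \<Longrightarrow> B j \<in> noise_sets"
  shows "integrable M (\<lambda>\<omega>. (\<Sum>j\<in>J. c j * W (B j) \<omega>)\<^sup>2)"
    and "(\<integral>\<omega>. (\<Sum>j\<in>J. c j * W (B j) \<omega>)\<^sup>2 \<partial>M)
           = (\<Sum>j\<in>J. \<Sum>k\<in>J. c j * c k * measure lborel (B j \<inter> B k))"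
proof -
  have eq: "(\<Sum>j\<in>J. c j * W (B j) \<omega>)\<^sup>2 = (\<Sum>j\<in>J. \<Sum>k\<in>J. c j * c k * (W (B j) \<omega> * W (B k) \<omega>))" for \<omega>
    by (simp add: power2_eq_square sum_product mult_ac)
  show "integrable M (\<lambda>\<omega>. (\<Sum>j\<in>J. c j * W (B j) \<omega>)\<^sup>2)"
    unfolding eq using assms by (intro Bochner_Integration.integrable_sum integrable_mult_right integrable_W_W) auto
  have "(\<integral>\<omega>. (\<Sum>j\<in>J. c j * W (B j) \<omega>)\<^sup>2 \<partial>M)
      = (\<Sum>j\<in>J. \<integral>\<omega>. (\<Sum>k\<in>J. c j * c k * (W (B j) \<omega> * W (B k) \<omega>)) \<partial>M)"
    unfolding eq using assms by (intro Bochner_Integration.integral_sum Bochner_Integration.integrable_sum integrable_mult_right integrable_W_W) auto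
  also have "\<dots> = (\<Sum>j\<in>J. \<Sum>k\<in>J. \<integral>\<omega>. c j * c k * (W (B j) \<omega> * W (B k) \<omega>) \<partial>M)"
    using assms by (intro sum.cong refl Bochner_Integration.integral_sum integrable_mult_right integrable_W_W) auto
  also have "\<dots> = (\<Sum>j\<in>J. \<Sum>k\<in>J. c j * c k * measure lborel (B j \<inter> B k))"
    using assms by (intro sum.cong refl) (simp add: integral_W_W)
  finally show "(\<integral>\<omega>. (\<Sum>j\<in>J. c j * W (B j) \<omega>)\<^sup>2 \<partial>M)
           = (\<Sum>j\<in>J. \<Sum>k\<in>J. c j * c k * measure lborel (B j \<inter> B k))" .
qed

text \<open>\<open>white_noise\<close> speaks of finite sets of regions, whereas an indexed family
  may repeat a region; coefficients of equal regions are therefore collected first.\<close>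

lemma gaussian_sum_W:
  assumes "finite J" "\<And>j. j \<in> J \<Longrightarrow> B j \<in> noise_sets"
  shows "gaussian_rv M (\<lambda>\<omega>. \<Sum>j\<in>J. c j * W (B j) \<omega>)"
proof -
  have "(\<Sum>j\<in>J. c j * W (B j) \<omega>) = (\<Sum>A\<in>B ` J. (\<Sum>j\<in>{j \<in> J. B j = A}. c j) * W A \<omega>)" for \<omega>
    by (subst sum.image_gen[OF assms(1), of _ B]) (auto simp: sum_distrib_right intro!: sum.cong)
  then show ?thesis
    using white_noise[unfolded white_noise_def, THEN conjunct1, rule_format, of "B ` J"
        "\<lambda>A. \<Sum>j\<in>{j \<in> J. B j = A}. c j"] assms by auto
qed

text \<open>Gaussianity yields some unnamed \<open>\<sigma>\<close>; computing the second moment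
  from the covariances as well identifies its square.\<close>

lemma integral_iexp_sum_W:
  assumes "finite J" "\<And>j. j \<in> J \<Longrightarrow> B j \<in> noise_sets"
  shows "(CLINT \<omega>|M. iexp (t * (\<Sum>j\<in>J. c j * W (B j) \<omega>)))
    = complex_of_real (exp (- (t\<^sup>2 * (\<Sum>j\<in>J. \<Sum>k\<in>J. c j * c k * measure lborel (B j \<inter> B k))) / 2))"
proof -
  have "gaussian_rv M (\<lambda>\<omega>. \<Sum>j\<in>J. c j * W (B j) \<omega>)" "(\<integral>\<omega>. (\<Sum>j\<in>J. c j * W (B j) \<omega>) \<partial>M) = 0"
    using assms by (intro gaussian_sum_W integral_sum_W; simp)+
  then obtain \<sigma> where s: "scaled_normal M (\<lambda>\<omega>. \<Sum>j\<in>J. c j * W (B j) \<omega>) \<sigma>"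
    by (rule gaussian_rv_scaled_normal)
  from scaled_normal.integral_iexp[OF s] scaled_normal.integral_X_square[OF s]
  show ?thesis using integral_sum_W_square(2)[of J B c] assms by simp
qed

text \<open>The quadratic form is the second moment of a combination of noise values.\<close>

lemma sum_measure_nonneg:
  assumes "finite J" "\<And>j. j \<in> J \<Longrightarrow> B j \<in> noise_sets"
  shows "0 \<le> (\<Sum>j\<in>J. \<Sum>k\<in>J. c j * c k * measure lborel (B j \<inter> B k))"
  using integral_sum_W_square(2)[of J B c] assms integral_nonneg_AE[of "\<lambda>\<omega>. (\<Sum>j\<in>J. c j * W (B j) \<omega>)\<^sup>2" M]
  by simp

lemma W_empty_AE: "AE \<omega> in M. W {} \<omega> = 0"
proof -
  have "{} \<in> noise_sets" by (simp add: noise_sets_def)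
  from integral_sum_W_square[of "{()}" "\<lambda>_. {}" "\<lambda>_. 1"] this
  have "integrable M (\<lambda>\<omega>. (W {} \<omega>)\<^sup>2)" "(\<integral>\<omega>. (W {} \<omega>)\<^sup>2 \<partial>M) = 0" by simp_all
  then have "AE \<omega> in M. (W {} \<omega>)\<^sup>2 = 0"
    by (subst (asm) integral_nonneg_eq_0_iff_AE) auto
  then show ?thesis by simp
qed

text \<open>By the covariances the second moment of the defect is |A Un B| + |A| + |B| - 2|A| - 2|B|
  + 2|A Int B| = 0. So additivity is only almost sure, with an exceptional set depending on the two
  regions.\<close>

lemma W_Un_AE:
  assumes A: "A \<in> noise_sets" and B: "B \<in> noise_sets" and "A \<inter> B = {}"
  shows "AE \<omega> in M. W (A \<union> B) \<omega> = W A \<omega> + W B \<omega>"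
proof -
  have AB: "A \<union> B \<in> noise_sets"
    using A B by (auto simp: noise_sets_def intro: le_less_trans[OF emeasure_subadditive])
  have fin: "emeasure lborel A \<noteq> \<infinity>" "emeasure lborel B \<noteq> \<infinity>" using A B by (auto simp: noise_sets_def)
  have m: "measure lborel (A \<union> B) = measure lborel A + measure lborel B"
    using A B assms fin by (intro measure_Union) (auto simp: noise_sets_def)
  define D where "D = (\<lambda>k::nat. if k = 0 then A \<union> B else if k = 1 then A else B)"
  define c where "c = (\<lambda>k::nat. if k = 0 then 1 else -1::real)"
  have D: "\<And>j. D j \<in> noise_sets" using A B AB by (simp add: D_def)
  have sq: "(\<Sum>j<3. c j * W (D j) \<omega>) = W (A \<union> B) \<omega> - W A \<omega> - W B \<omega>" for \<omega>
    by (simp add: numeral_3_eq_3 D_def c_def)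
  have [simp]: "(A \<union> B) \<inter> A = A" "(A \<union> B) \<inter> B = B" "A \<inter> (A \<union> B) = A" "B \<inter> (A \<union> B) = B" "B \<inter> A = {}"
    using assms by auto
  from integral_sum_W_square[of "{..<3}" D c, unfolded sq] D
  have "integrable M (\<lambda>\<omega>. (W (A \<union> B) \<omega> - W A \<omega> - W B \<omega>)\<^sup>2)"
    "(\<integral>\<omega>. (W (A \<union> B) \<omega> - W A \<omega> - W B \<omega>)\<^sup>2 \<partial>M) = 0" 
    by (simp_all add: numeral_3_eq_3 D_def c_def m assms)
  then have "AE \<omega> in M. (W (A \<union> B) \<omega> - W A \<omega> - W B \<omega>)\<^sup>2 = 0"
    by (subst (asm) integral_nonneg_eq_0_iff_AE) auto
  then show ?thesis by (rule AE_mp) auto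
qed

end

text \<open>On the nonnegative half-line exp (- y) has slope at most 1 in modulus. Applied to
  exponents proportional to \<open>l\<^sup>2 / 2\<close>, this produces the constant of the final
  estimate.\<close>

lemma exp_minus_lipschitz:
  fixes a b :: real
  assumes "0 \<le> a" "0 \<le> b"
  shows "\<bar>exp (- a) - exp (- b)\<bar> \<le> \<bar>a - b\<bar>"
proof -
  have *: "exp (- a) - exp (- b) \<le> b - a" if "0 \<le> a" "a \<le> b" for a b :: real
  proof -
    have "exp (- a) - exp (- b) = exp (- a) * (1 - exp (- (b - a)))"
      by (simp add: algebra_simps flip: exp_add)
    also have "\<dots> \<le> 1 * (b - a)"
    proof (rule mult_mono)
      show "1 - exp (- (b - a)) \<le> b - a"
        using exp_ge_add_one_self[of "- (b - a)"] by linarith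
    qed (use that in auto)
    finally show ?thesis by simp
  qed
  show ?thesis
    using *[of a b] *[of b a] assms by (cases "a \<le> b") (auto simp: abs_if)
qed

text \<open>The library version \<open>Bochner_Integration.integral_norm_bound_integral\<close> is restricted to
  measures on Euclidean spaces.\<close>

lemma integral_norm_le_integral:
  fixes f :: "'a \<Rightarrow> 'b::{banach, second_countable_topology}"
  assumes "integrable M f" "integrable M g" "\<And>x. x \<in> space M \<Longrightarrow> norm (f x) \<le> g x"
  shows "norm (\<integral>x. f x \<partial>M) \<le> (\<integral>x. g x \<partial>M)"
  by (rule order_trans[OF integral_norm_bound integral_mono[OF integrable_norm[OF assms(1)] assms(2,3)]])

section \<open>Freezing the past: independence of \<open>F r\<close> and the noise after
  \<open>r\<close>\<close>

context white_noise_space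
begin

lemma space_F: "space (F r) = space M"
  using noise_filtration by (auto simp: noise_filtration_def subalgebra_def)

lemma sets_F_subset: "sets (F r) \<subseteq> sets M"
  using noise_filtration by (auto simp: noise_filtration_def subalgebra_def)

lemma measurable_F_M: "f \<in> measurable (F r) N \<Longrightarrow> f \<in> measurable M N"
  using noise_filtration by (auto simp: noise_filtration_def intro: measurable_from_subalg)

lemma measurable_F_mono: "r \<le> r' \<Longrightarrow> f \<in> measurable (F r) N \<Longrightarrow> f \<in> measurable (F r') N"
  using noise_filtration
  by (elim measurable_from_subalg[rotated]) (auto simp: noise_filtration_def filtration_def subalgebra_def)

lemma measurable_W_F:
  "0 \<le> r \<Longrightarrow> A \<in> noise_sets \<Longrightarrow> A \<subseteq> UNIV \<times> {..r} \<Longrightarrow> W A \<in> borel_measurable (F r)"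
  using noise_filtration by (auto simp: noise_filtration_def)

text \<open>Packaged as a measure space so that maps into it are random variables; only its
  sigma-algebra matters.\<close>

definition future :: "real \<Rightarrow> 'a measure" where
  "future r = sigma (space M)
     {W A -` B \<inter> space M | A B. A \<in> noise_sets \<and> A \<subseteq> UNIV \<times> {r<..} \<and> B \<in> sets borel}"

lemma space_future: "space (future r) = space M"
  unfolding future_def by (subst space_measure_of) auto

lemma sets_future: "sets (future r) = sigma_sets (space M)
     {W A -` B \<inter> space M | A B. A \<in> noise_sets \<and> A \<subseteq> UNIV \<times> {r<..} \<and> B \<in> sets borel}"
  unfolding future_def by (subst sets_measure_of) auto

lemma measurable_W_future:
  "A \<in> noise_sets \<Longrightarrow> A \<subseteq> UNIV \<times> {r<..} \<Longrightarrow> W A \<in> borel_measurable (future r)"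
  by (rule measurableI) (auto simp: space_future sets_future)

text \<open>The identity is read as two random variables, with values in \<open>F r\<close> and in
  \<open>future r\<close>. Their independence means that the diagonal map has a product law.\<close>

lemma distr_past_future:
  assumes "0 \<le> r"
  shows "distr M (F r \<Otimes>\<^sub>M future r) (\<lambda>\<omega>. (\<omega>, \<omega>)) = distr M (F r) (\<lambda>\<omega>. \<omega>) \<Otimes>\<^sub>M distr M (future r) (\<lambda>\<omega>. \<omega>)"
    and "(\<lambda>\<omega>. \<omega>) \<in> measurable M (F r)" and "(\<lambda>\<omega>. \<omega>) \<in> measurable M (future r)"
proof -
  have ind: "indep_set (sets (F r)) (sets (future r))"
    using noise_filtration assms by (auto simp: noise_filtration_def sets_future)
  have "sets (future r) \<subseteq> sets M" using ind by (auto simp: indep_set_def indep_sets_def UNIV_bool)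
  have 1: "{(\<lambda>\<omega>. \<omega>) -` A \<inter> space M | A. A \<in> sets N} = sets N" if "space N = space M" for N
    unfolding that[symmetric] vimage_ident
    by (simp add: Setcompr_eq_image sets.Int_space_eq2 cong: image_cong_simp)
  have rv: "(\<lambda>\<omega>. \<omega>) \<in> measurable M N" if "space N = space M" "sets N \<subseteq> sets M" for N
  proof (rule measurableI)
    fix A assume "A \<in> sets N"
    then show "(\<lambda>\<omega>. \<omega>) -` A \<inter> space M \<in> sets M"
      unfolding that(1)[symmetric] vimage_ident using that(2) by (auto simp: sets.Int_space_eq2)
  qed (simp add: that)
  have "indep_var (F r) (\<lambda>\<omega>. \<omega>) (future r) (\<lambda>\<omega>. \<omega>)"
    unfolding indep_var_eq 1[OF space_F] 1[OF space_future]
    using ind rv[OF space_F sets_F_subset] rv[OF space_future \<open>sets (future r) \<subseteq> sets M\<close>]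
      sets.sigma_sets_eq[of "F r"] sets.sigma_sets_eq[of "future r"]
    by (simp add: space_F space_future)
  then show "distr M (F r \<Otimes>\<^sub>M future r) (\<lambda>\<omega>. (\<omega>, \<omega>)) = distr M (F r) (\<lambda>\<omega>. \<omega>) \<Otimes>\<^sub>M distr M (future r) (\<lambda>\<omega>. \<omega>)"
     "(\<lambda>\<omega>. \<omega>) \<in> measurable M (F r)" "(\<lambda>\<omega>. \<omega>) \<in> measurable M (future r)"
    unfolding indep_var_distribution_eq by auto
qed

text \<open>Fubini for that product law: the past coordinate is frozen while the future one is
  averaged. This takes the place of conditional expectation given \<open>F r\<close>.\<close>

lemma integral_past_future:
  fixes h :: "'a \<times> 'a \<Rightarrow> complex"
  assumes "0 \<le> r" and h: "h \<in> borel_measurable (F r \<Otimes>\<^sub>M future r)"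
    and bound: "\<And>\<omega> \<omega>'. \<omega> \<in> space M \<Longrightarrow> \<omega>' \<in> space M \<Longrightarrow> norm (h (\<omega>, \<omega>')) \<le> C"
  shows "(\<integral>\<omega>. h (\<omega>, \<omega>) \<partial>M) = (\<integral>\<omega>. (\<integral>\<omega>'. h (\<omega>, \<omega>') \<partial>M) \<partial>M)"
proof -
  note d = distr_past_future[OF assms(1)]
  let ?F = "distr M (F r) (\<lambda>\<omega>. \<omega>)" and ?G = "distr M (future r) (\<lambda>\<omega>. \<omega>)"
  have "prob_space ?F" "prob_space ?G" using d(2,3) by (auto intro: prob_space_distr)
  then interpret P: pair_prob_space ?F ?G
    by (simp add: pair_prob_space_def pair_sigma_finite_def prob_space_imp_sigma_finite)
  have h' [measurable]: "h \<in> borel_measurable (?F \<Otimes>\<^sub>M ?G)" using h by simp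
  have int: "integrable (?F \<Otimes>\<^sub>M ?G) h"
    using bound by (intro P.integrable_const_bound[where B=C]) (auto simp: space_pair_measure space_F space_future intro!: AE_I2)
  have pm: "(\<lambda>\<omega>. (\<omega>, \<omega>)) \<in> measurable M (F r \<Otimes>\<^sub>M future r)"
    using d(2,3) by (rule measurable_Pair)
  have "(\<integral>\<omega>. h (\<omega>, \<omega>) \<partial>M) = (\<integral>p. h p \<partial>(?F \<Otimes>\<^sub>M ?G))"
    using integral_distr[OF pm h] d(1) by simp
  also have "\<dots> = (\<integral>\<omega>. (\<integral>\<omega>'. h (\<omega>, \<omega>') \<partial>?G) \<partial>?F)"
    by (rule P.integral_fst'[OF int, symmetric])
  also have "\<dots> = (\<integral>\<omega>. (\<integral>\<omega>'. h (\<omega>, \<omega>') \<partial>?G) \<partial>M)"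
    by (rule integral_distr[OF d(2)])
      (use P.M2.borel_measurable_lebesgue_integral[of "\<lambda>\<omega> \<omega>'. h (\<omega>, \<omega>')" "F r"] h in simp)
  also have "\<dots> = (\<integral>\<omega>. (\<integral>\<omega>'. h (\<omega>, \<omega>') \<partial>M) \<partial>M)"
  proof (rule Bochner_Integration.integral_cong[OF refl])
    fix \<omega> assume "\<omega> \<in> space M"
    then have "\<omega> \<in> space (F r)" by (simp add: space_F)
    from measurable_compose[OF measurable_Pair1'[OF this] h]
    show "(\<integral>\<omega>'. h (\<omega>, \<omega>') \<partial>?G) = (\<integral>\<omega>'. h (\<omega>, \<omega>') \<partial>M)"
      by (rule integral_distr[OF d(3)])
  qed
  finally show ?thesis .
qed

text \<open>Once the past is frozen, the coefficients are constants and the sum is a centred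
  Gaussian, whose characteristic function replaces the oscillating factor. \<open>Y\<close> carries
  everything already known at time \<open>r\<close>.\<close>

lemma integral_iexp_future:
  fixes Y :: "'a \<Rightarrow> complex"
  assumes "0 \<le> r" "finite J" and B: "\<And>j. j \<in> J \<Longrightarrow> B j \<in> noise_sets" "\<And>j. j \<in> J \<Longrightarrow> B j \<subseteq> UNIV \<times> {r<..}"
    and Y: "Y \<in> borel_measurable (F r)" "\<And>\<omega>. \<omega> \<in> space M \<Longrightarrow> norm (Y \<omega>) \<le> C"
    and c: "\<And>j. j \<in> J \<Longrightarrow> c j \<in> borel_measurable (F r)"
  shows "(\<integral>\<omega>. Y \<omega> * iexp (t * (\<Sum>j\<in>J. c j \<omega> * W (B j) \<omega>)) \<partial>M)
    = (\<integral>\<omega>. Y \<omega> * complex_of_real (exp (- (t\<^sup>2 * (\<Sum>j\<in>J. \<Sum>k\<in>J. c j \<omega> * c k \<omega> * measure lborel (B j \<inter> B k))) / 2)) \<partial>M)"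
proof -
  define h where "h = (\<lambda>p. Y (fst p) * iexp (t * (\<Sum>j\<in>J. c j (fst p) * W (B j) (snd p))))"
  have [measurable]: "W (B j) \<in> borel_measurable (future r)" "c j \<in> borel_measurable (F r)" if "j \<in> J" for j
    using that B c by (auto intro: measurable_W_future)
  note Y(1) [measurable]
  have "h \<in> borel_measurable (F r \<Otimes>\<^sub>M future r)"
    unfolding h_def by measurable
  then have *: "(\<integral>\<omega>. h (\<omega>, \<omega>) \<partial>M) = (\<integral>\<omega>. (\<integral>\<omega>'. h (\<omega>, \<omega>') \<partial>M) \<partial>M)"
  proof (rule integral_past_future[OF assms(1)])
    show "norm (h (\<omega>, \<omega>')) \<le> C" if "\<omega> \<in> space M" for \<omega> \<omega>'
      unfolding h_def norm_mult norm_exp_i_times using Y(2)[OF that] by simp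
  qed
  have "(\<integral>\<omega>'. h (\<omega>, \<omega>') \<partial>M) = Y \<omega> * complex_of_real
      (exp (- (t\<^sup>2 * (\<Sum>j\<in>J. \<Sum>k\<in>J. c j \<omega> * c k \<omega> * measure lborel (B j \<inter> B k))) / 2))" for \<omega>
    using integral_iexp_sum_W[OF assms(2) B(1), where t=t and c="\<lambda>j. c j \<omega>"]
    by (simp only: h_def fst_conv snd_conv integral_mult_right_zero)
  with * show ?thesis by (simp only: h_def fst_conv snd_conv)
qed

end

text \<open>The one-step estimates need an interval with no starting time \<open>a j\<close> in its
  interior. Splitting at such a point removes it from both open halves, so induction on the number
  of interior points applies.\<close>

lemma interval_chain:
  fixes P :: "real \<Rightarrow> real \<Rightarrow> bool"
  assumes "finite E" "r \<le> r'"
    and free: "\<And>s s'. r \<le> s \<Longrightarrow> s \<le> s' \<Longrightarrow> E \<inter> {s<..<s'} = {} \<Longrightarrow> P s s'"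
    and trans: "\<And>s s' s''. P s s' \<Longrightarrow> P s' s'' \<Longrightarrow> P s s''"
  shows "P r r'"
proof -
  have "P s s'" if "r \<le> s" "s \<le> s'" for s s'
    using that
  proof (induction "card (E \<inter> {s<..<s'})" arbitrary: s s' rule: less_induct)
    case less
    show ?case
    proof (cases "E \<inter> {s<..<s'} = {}")
      case True
      with free less.prems show ?thesis by blast
    next
      case False
      then obtain e where e: "e \<in> E" "s < e" "e < s'" by auto
      have "card (E \<inter> {s<..<e}) < card (E \<inter> {s<..<s'})" "card (E \<inter> {e<..<s'}) < card (E \<inter> {s<..<s'})"
        using e assms(1) by (auto intro!: psubset_card_mono)
      then have "P s e" "P e s'" using less e by auto
      then show ?thesis by (rule trans)
    qed
  qed
  then show ?thesis using assms(2) by blast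
qed

section \<open>Elementary integrands\<close>

locale simple_integrand = white_noise_space M F W
  for M :: "'a measure" and F W +
  fixes J :: "'j set" and \<xi> :: "'j \<Rightarrow> 'a \<Rightarrow> real" and a b :: "'j \<Rightarrow> real" and A :: "'j \<Rightarrow> real set"
  assumes finite_J: "finite J"
    and a_nonneg: "\<And>j. j \<in> J \<Longrightarrow> 0 \<le> a j"
    and sets_A: "\<And>j. j \<in> J \<Longrightarrow> A j \<in> sets borel"
    and finite_A: "\<And>j. j \<in> J \<Longrightarrow> emeasure lborel (A j) < \<infinity>"
    and measurable_\<xi>: "\<And>j. j \<in> J \<Longrightarrow> \<xi> j \<in> borel_measurable (F (a j))"
    and bounded_\<xi>: "\<And>j. j \<in> J \<Longrightarrow> \<exists>C. \<forall>\<omega>\<in>space M. \<bar>\<xi> j \<omega>\<bar> \<le> C"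
begin

text \<open>Taken from time 0 this is the region consumed up to \<open>r'\<close>; taken from
  \<open>r\<close> it lies in the future of \<open>r\<close>, as independence requires.\<close>

definition strip :: "'j \<Rightarrow> real \<Rightarrow> real \<Rightarrow> (real \<times> real) set" where
  "strip j r r' = A j \<times> ({a j<..b j} \<inter> {r<..r'})"

text \<open>Truncating the coefficients makes them adapted; it does not affect the integral up to time \<open>r\<close>,
  as \<^term>\<open>strip j 0 r\<close> is empty when \<^term>\<open>r < a j\<close>.\<close>

definition coef :: "'j \<Rightarrow> real \<Rightarrow> 'a \<Rightarrow> real" where
  "coef j r \<omega> = (if a j \<le> r then \<xi> j \<omega> else 0)"

definition wint :: "real \<Rightarrow> 'a \<Rightarrow> real" where
  "wint r \<omega> = (\<Sum>j\<in>J. coef j r \<omega> * W (strip j 0 r) \<omega>)"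

text \<open>The integral of the squared integrand along the path, with the square multiplied out
  over pairs of terms, so the rectangles may overlap.\<close>

definition qvar :: "real \<Rightarrow> 'a \<Rightarrow> real" where
  "qvar r \<omega> = (\<Sum>j\<in>J. \<Sum>k\<in>J. \<xi> j \<omega> * \<xi> k \<omega> * measure lborel (strip j 0 r \<inter> strip k 0 r))"

lemma strip_noise_sets:
  assumes "j \<in> J" "0 \<le> r" shows "strip j r r' \<in> noise_sets"
proof -
  have "emeasure lborel (strip j r r') \<le> emeasure lborel (A j \<times> {r<..r'})"
    using sets_A[OF assms(1)] by (intro emeasure_mono) (auto simp: strip_def simp flip: borel_prod)
  also have "\<dots> = emeasure lborel (A j) * emeasure lborel {r<..r'}"
    using sets_A[OF assms(1)] by (subst lborel_prod[symmetric], subst lborel.emeasure_pair_measure_Times) auto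
  also have "\<dots> < \<infinity>"
    using finite_A[OF assms(1)] by (cases "r \<le> r'") (auto simp: ennreal_mult_less_top)
  finally show ?thesis
    using sets_A[OF assms(1)] assms by (auto simp: noise_sets_def strip_def simp flip: borel_prod)
qed

lemma strip_Un:
  "0 \<le> r \<Longrightarrow> r \<le> r' \<Longrightarrow> strip j 0 r' = strip j 0 r \<union> strip j r r'"
  by (auto simp: strip_def)

lemma measurable_coef [measurable]: "j \<in> J \<Longrightarrow> coef j r \<in> borel_measurable (F r)"
  using measurable_F_mono[OF _ measurable_\<xi>, of j r] by (cases "a j \<le> r") (simp_all add: coef_def[abs_def])

lemma measurable_wint: "0 \<le> r \<Longrightarrow> wint r \<in> borel_measurable (F r)"
proof -
  assume "0 \<le> r"
  have [measurable]: "W (strip j 0 r) \<in> borel_measurable (F r)" if "j \<in> J" for j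
    using that \<open>0 \<le> r\<close> by (intro measurable_W_F strip_noise_sets) (auto simp: strip_def)
  show ?thesis unfolding wint_def by measurable
qed

text \<open>Makes adaptedness visible: a coefficient not yet known at time \<open>r\<close> meets
  only an empty strip.\<close>

lemma qvar_coef:
  "qvar r \<omega> = (\<Sum>j\<in>J. \<Sum>k\<in>J. coef j r \<omega> * coef k r \<omega> * measure lborel (strip j 0 r \<inter> strip k 0 r))"
proof -
  have "strip j 0 r = {}" if "\<not> a j \<le> r" for j using that by (auto simp: strip_def)
  then show ?thesis unfolding qvar_def coef_def by (intro sum.cong) auto
qed

lemma measurable_qvar: "qvar r \<in> borel_measurable (F r)"
  unfolding qvar_coef[abs_def] by measurable

text \<open>No term starts strictly between \<open>r\<close> and \<open>r'\<close>, so the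
  coefficients of the new noise are all known at time \<open>r\<close>.\<close>

lemma wint_step:
  assumes "0 \<le> r" "r \<le> r'" "a ` J \<inter> {r<..<r'} = {}"
  shows "AE \<omega> in M. wint r' \<omega> = wint r \<omega> + (\<Sum>j\<in>J. coef j r \<omega> * W (strip j r r') \<omega>)"
proof -
  have "AE \<omega> in M. \<forall>j\<in>J. W (strip j 0 r') \<omega> = W (strip j 0 r) \<omega> + W (strip j r r') \<omega>"
    using finite_J
  proof (rule AE_finite_allI)
    fix j assume "j \<in> J"
    then show "AE \<omega> in M. W (strip j 0 r') \<omega> = W (strip j 0 r) \<omega> + W (strip j r r') \<omega>"
      unfolding strip_Un[OF assms(1,2)] using assms
      by (intro W_Un_AE strip_noise_sets) (auto simp: strip_def)
  qed
  then show ?thesis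
    using W_empty_AE
  proof eventually_elim
    fix \<omega> assume eq: "\<forall>j\<in>J. W (strip j 0 r') \<omega> = W (strip j 0 r) \<omega> + W (strip j r r') \<omega>"
      and zero: "W {} \<omega> = 0"
    have "coef j r' \<omega> * W (strip j 0 r') \<omega> = coef j r \<omega> * W (strip j 0 r) \<omega> + coef j r \<omega> * W (strip j r r') \<omega>"
      if "j \<in> J" for j
    proof (cases "a j \<le> r")
      case True
      then show ?thesis using eq that assms(2) by (simp add: coef_def distrib_left)
    next
      case False
      \<comment> \<open>A term starting exactly at \<open>r'\<close> may have a nonzero coefficient
        there but no noise yet; it contributes a multiple of \<open>W {}\<close>, which vanishes
        only almost surely.\<close>
      then have "a j \<ge> r'" using assms(3) that by force
      then have "strip j 0 r' = {}" by (auto simp: strip_def)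
      then show ?thesis using False zero by (simp add: coef_def)
    qed
    then show "wint r' \<omega> = wint r \<omega> + (\<Sum>j\<in>J. coef j r \<omega> * W (strip j r r') \<omega>)"
      by (simp add: wint_def sum.distrib)
  qed
qed

lemma strip_Int_finite:
  assumes "j \<in> J" "k \<in> J" "0 \<le> r"
  shows "strip j r r' \<inter> strip k r r' \<in> sets lborel" "emeasure lborel (strip j r r' \<inter> strip k r r') \<noteq> \<infinity>"
proof -
  have n: "strip j r r' \<in> noise_sets" "strip k r r' \<in> noise_sets"
    using assms by (auto intro: strip_noise_sets)
  then show "strip j r r' \<inter> strip k r r' \<in> sets lborel" by (auto simp: noise_sets_def)
  have "emeasure lborel (strip j r r' \<inter> strip k r r') \<le> emeasure lborel (strip j r r')"
    using n by (intro emeasure_mono) (auto simp: noise_sets_def)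
  also have "\<dots> < \<infinity>" using n by (simp add: noise_sets_def)
  finally show "emeasure lborel (strip j r r' \<inter> strip k r r') \<noteq> \<infinity>" by simp
qed

text \<open>Pathwise counterpart of \<open>wint_step\<close>: the windows before and after
  \<open>r\<close> are disjoint, so no cross terms arise.\<close>

lemma qvar_step:
  assumes "0 \<le> r" "r \<le> r'" "a ` J \<inter> {r<..<r'} = {}"
  shows "qvar r' \<omega> = qvar r \<omega> +
    (\<Sum>j\<in>J. \<Sum>k\<in>J. coef j r \<omega> * coef k r \<omega> * measure lborel (strip j r r' \<inter> strip k r r'))"
proof -
  have "\<xi> j \<omega> * \<xi> k \<omega> * measure lborel (strip j 0 r' \<inter> strip k 0 r') =
      \<xi> j \<omega> * \<xi> k \<omega> * measure lborel (strip j 0 r \<inter> strip k 0 r) +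
      coef j r \<omega> * coef k r \<omega> * measure lborel (strip j r r' \<inter> strip k r r')"
    if "j \<in> J" "k \<in> J" for j k
  proof -
    have "strip j 0 r' \<inter> strip k 0 r' = (strip j 0 r \<inter> strip k 0 r) \<union> (strip j r r' \<inter> strip k r r')"
      using assms(1,2) by (auto simp: strip_def)
    moreover have disj: "(strip j 0 r \<inter> strip k 0 r) \<inter> (strip j r r' \<inter> strip k r r') = {}"
      by (auto simp: strip_def)
    ultimately have "measure lborel (strip j 0 r' \<inter> strip k 0 r')
        = measure lborel (strip j 0 r \<inter> strip k 0 r) + measure lborel (strip j r r' \<inter> strip k r r')"
      using measure_Union[OF strip_Int_finite(2)[OF that order_refl] strip_Int_finite(2)[OF that assms(1)]
          strip_Int_finite(1)[OF that order_refl] strip_Int_finite(1)[OF that assms(1)] disj]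
      by simp
    moreover have "strip j r r' = {}" if "\<not> a j \<le> r" "j \<in> J" for j
      using that assms(3) by (force simp: strip_def)
    ultimately show ?thesis
      using that by (cases "a j \<le> r"; cases "a k \<le> r") (auto simp: coef_def algebra_simps)
  qed
  then show ?thesis by (simp add: qvar_def flip: sum.distrib)
qed

lemma bounded_qvar: "\<exists>C. \<forall>\<omega>\<in>space M. \<bar>qvar r \<omega>\<bar> \<le> C"
proof -
  have "\<forall>j. \<exists>C. j \<in> J \<longrightarrow> (\<forall>\<omega>\<in>space M. \<bar>\<xi> j \<omega>\<bar> \<le> C)" using bounded_\<xi> by blast
  then obtain C where C: "\<And>j \<omega>. j \<in> J \<Longrightarrow> \<omega> \<in> space M \<Longrightarrow> \<bar>\<xi> j \<omega>\<bar> \<le> C j" by metis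
  have C0: "\<bar>\<xi> j \<omega>\<bar> \<le> \<bar>C j\<bar>" if "j \<in> J" "\<omega> \<in> space M" for j \<omega> using C[OF that] by linarith
  have "\<bar>qvar r \<omega>\<bar> \<le> (\<Sum>j\<in>J. \<Sum>k\<in>J. \<bar>C j\<bar> * \<bar>C k\<bar> * measure lborel (strip j 0 r \<inter> strip k 0 r))"
    if "\<omega> \<in> space M" for \<omega>
    unfolding qvar_def using that
    by (intro sum_abs[THEN order_trans] sum_mono)
      (auto simp: abs_mult intro!: mult_mono C0)
  then show ?thesis by blast
qed

lemma integrable_qvar: "integrable M (qvar r)"
proof -
  obtain C where "\<forall>\<omega>\<in>space M. \<bar>qvar r \<omega>\<bar> \<le> C" using bounded_qvar by blast
  then show ?thesis
    using measurable_F_M[OF measurable_qvar] by (intro integrable_const_bound[where B=C]) auto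
qed

text \<open>If the quadratic variation at time \<open>T\<close> is \<open>T\<close>, this is
  \<open>exp (- l\<^sup>2 T / 2)\<close> times the exponential martingale of \<^term>\<open>wint\<close>. The truncation
  \<^term>\<open>min (qvar r \<omega>) T\<close> keeps it bounded by \<open>1\<close>; the martingale property then only fails by the
  increments of the excess of the quadratic variation over \<open>T\<close>.\<close>

definition damped :: "real \<Rightarrow> real \<Rightarrow> real \<Rightarrow> 'a \<Rightarrow> complex" where
  "damped l T r \<omega> = iexp (l * wint r \<omega>) * complex_of_real (exp (- (l\<^sup>2 / 2 * (T - min (qvar r \<omega>) T))))"

lemma integrable_damped:
  assumes "0 \<le> r" shows "integrable M (damped l T r)"
proof (rule integrable_const_bound[where B=1])
  have [measurable]: "wint r \<in> borel_measurable M" "qvar r \<in> borel_measurable M"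
    using assms by (auto intro: measurable_F_M measurable_wint measurable_qvar)
  show "damped l T r \<in> borel_measurable M" unfolding damped_def by measurable
  show "AE \<omega> in M. norm (damped l T r \<omega>) \<le> 1"
    by (auto simp: damped_def norm_mult intro!: AE_I2 mult_nonneg_nonneg simp del: of_real_mult)
qed

lemma damped_step:
  assumes "0 \<le> r" "r \<le> r'" "a ` J \<inter> {r<..<r'} = {}"
  shows "norm ((\<integral>\<omega>. damped l T r' \<omega> \<partial>M) - (\<integral>\<omega>. damped l T r \<omega> \<partial>M))
    \<le> l\<^sup>2 / 2 * ((\<integral>\<omega>. max (qvar r' \<omega> - T) 0 \<partial>M) - (\<integral>\<omega>. max (qvar r \<omega> - T) 0 \<partial>M))"
proof -
  define V where "V = (\<lambda>\<omega>. \<Sum>j\<in>J. \<Sum>k\<in>J. coef j r \<omega> * coef k r \<omega> * measure lborel (strip j r r' \<inter> strip k r r'))"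
  have V: "qvar r' \<omega> = qvar r \<omega> + V \<omega>" for \<omega> unfolding V_def by (rule qvar_step[OF assms])
  have V0: "0 \<le> V \<omega>" for \<omega>
    unfolding V_def using strip_noise_sets assms(1) finite_J by (intro sum_measure_nonneg) auto
  \<comment> \<open>The damping at the later time is already known at time \<open>r\<close>, because
    V uses only the coefficients known then. So \<open>Y\<close> is all of
    \<open>damped l T r'\<close> except the new noise.\<close>
  define Y where "Y = (\<lambda>\<omega>. iexp (l * wint r \<omega>) * complex_of_real (exp (- (l\<^sup>2 / 2 * (T - min (qvar r' \<omega>) T)))))"
  have [measurable]: "wint r \<in> borel_measurable (F r)" "qvar r \<in> borel_measurable (F r)"
    using assms by (auto intro: measurable_wint measurable_qvar)
  have V_meas [measurable]: "V \<in> borel_measurable (F r)" unfolding V_def by measurable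
  have Y [measurable]: "Y \<in> borel_measurable (F r)" unfolding Y_def V by measurable
  have [measurable]: "V \<in> borel_measurable M" "Y \<in> borel_measurable M" "wint r \<in> borel_measurable M" "wint r' \<in> borel_measurable M"
    using measurable_F_M[OF Y] measurable_F_M[OF V_meas] measurable_F_M[OF measurable_wint] assms by auto
  have [measurable]: "\<And>s. qvar s \<in> borel_measurable M" by (rule measurable_F_M[OF measurable_qvar])
  have Y1: "norm (Y \<omega>) \<le> 1" for \<omega>
    unfolding Y_def norm_mult norm_exp_i_times norm_of_real by simp
  have [measurable]: "W (strip j r r') \<in> borel_measurable M" "coef j r \<in> borel_measurable M" if "j \<in> J" for j
    using that assms(1) strip_noise_sets by (auto intro: measurable_W measurable_F_M measurable_coef)
  have "(\<integral>\<omega>. damped l T r' \<omega> \<partial>M) = (\<integral>\<omega>. Y \<omega> * iexp (l * (\<Sum>j\<in>J. coef j r \<omega> * W (strip j r r') \<omega>)) \<partial>M)"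
  proof (rule integral_cong_AE)
    show "AE \<omega> in M. damped l T r' \<omega> = Y \<omega> * iexp (l * (\<Sum>j\<in>J. coef j r \<omega> * W (strip j r r') \<omega>))"
      using wint_step[OF assms]
    proof eventually_elim
      case (elim \<omega>)
      then have "iexp (l * wint r' \<omega>) = iexp (l * wint r \<omega>) * iexp (l * (\<Sum>j\<in>J. coef j r \<omega> * W (strip j r r') \<omega>))"
        by (simp only: elim distrib_left of_real_add exp_add)
      then show ?case unfolding damped_def Y_def by simp
    qed
  qed (use integrable_damped[of r' l T] assms in \<open>auto dest: borel_measurable_integrable\<close>)
  also have "\<dots> = (\<integral>\<omega>. Y \<omega> * complex_of_real (exp (- (l\<^sup>2 * V \<omega>) / 2)) \<partial>M)"
    unfolding V_def using assms(1) finite_J strip_noise_sets Y Y1 measurable_coef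
    by (intro integral_iexp_future[where C=1]) (auto simp: strip_def)
  finally have eq: "(\<integral>\<omega>. damped l T r' \<omega> \<partial>M) = (\<integral>\<omega>. Y \<omega> * complex_of_real (exp (- (l\<^sup>2 * V \<omega>) / 2)) \<partial>M)" .
  have int: "integrable M (\<lambda>\<omega>. Y \<omega> * complex_of_real (exp (- (l\<^sup>2 * V \<omega>) / 2)))"
  proof (rule integrable_const_bound[where B=1])
    show "AE \<omega> in M. norm (Y \<omega> * complex_of_real (exp (- (l\<^sup>2 * V \<omega>) / 2))) \<le> 1"
      unfolding norm_mult using Y1 V0 by (intro AE_I2 mult_le_one) auto
  qed measurable
  have bound: "norm (Y \<omega> * complex_of_real (exp (- (l\<^sup>2 * V \<omega>) / 2)) - damped l T r \<omega>)
      \<le> l\<^sup>2 / 2 * (max (qvar r' \<omega> - T) 0 - max (qvar r \<omega> - T) 0)" for \<omega>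
  proof -
    let ?x = "l\<^sup>2 / 2 * (T - min (qvar r' \<omega>) T) + l\<^sup>2 * V \<omega> / 2" and ?z = "l\<^sup>2 / 2 * (T - min (qvar r \<omega>) T)"
    have x: "?x = l\<^sup>2 / 2 * ((T - min (qvar r' \<omega>) T) + V \<omega>)" by (simp add: algebra_simps)
    have "Y \<omega> * complex_of_real (exp (- (l\<^sup>2 * V \<omega>) / 2)) - damped l T r \<omega>
      = iexp (l * wint r \<omega>) * complex_of_real (exp (- (l\<^sup>2 / 2 * (T - min (qvar r' \<omega>) T))) * exp (- (l\<^sup>2 * V \<omega>) / 2) - exp (- ?z))"
      unfolding Y_def damped_def of_real_mult of_real_diff by (simp add: algebra_simps)
    also have "exp (- (l\<^sup>2 / 2 * (T - min (qvar r' \<omega>) T))) * exp (- (l\<^sup>2 * V \<omega>) / 2) = exp (- ?x)"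
      by (simp flip: exp_add)
    finally have "norm (Y \<omega> * complex_of_real (exp (- (l\<^sup>2 * V \<omega>) / 2)) - damped l T r \<omega>) = \<bar>exp (- ?x) - exp (- ?z)\<bar>"
      by (simp only: norm_mult norm_exp_i_times norm_of_real mult_1_left)
    also have "\<dots> \<le> \<bar>?x - ?z\<bar>"
      using V0[of \<omega>] by (intro exp_minus_lipschitz add_nonneg_nonneg mult_nonneg_nonneg) auto
    \<comment> \<open>Uses \<open>y - min y T = max (y - T) 0\<close> for y the quadratic variation
      at \<open>r\<close> and at \<open>r'\<close>.\<close>
    also have "?x - ?z = l\<^sup>2 / 2 * (max (qvar r' \<omega> - T) 0 - max (qvar r \<omega> - T) 0)"
      unfolding x right_diff_distrib[symmetric] using V[of \<omega>] by (intro arg_cong2[where f="(*)"] refl) (auto simp: max_def min_def)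
    also have "\<bar>\<dots>\<bar> = \<dots>"
      using V0[of \<omega>] by (intro abs_of_nonneg mult_nonneg_nonneg) (auto simp: V)
    finally show ?thesis .
  qed
  have intm: "integrable M (\<lambda>\<omega>. max (qvar s \<omega> - T) 0)" for s
    by (intro integrable_max Bochner_Integration.integrable_diff integrable_qvar) auto
  have "norm ((\<integral>\<omega>. damped l T r' \<omega> \<partial>M) - (\<integral>\<omega>. damped l T r \<omega> \<partial>M))
    = norm (\<integral>\<omega>. Y \<omega> * complex_of_real (exp (- (l\<^sup>2 * V \<omega>) / 2)) - damped l T r \<omega> \<partial>M)"
    unfolding eq using int integrable_damped[OF assms(1)] by simp
  also have "\<dots> \<le> (\<integral>\<omega>. l\<^sup>2 / 2 * (max (qvar r' \<omega> - T) 0 - max (qvar r \<omega> - T) 0) \<partial>M)"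
    using bound intm
    by (intro integral_norm_le_integral Bochner_Integration.integrable_diff int integrable_damped[OF assms(1)] integrable_mult_right) auto
  also have "\<dots> = l\<^sup>2 / 2 * ((\<integral>\<omega>. max (qvar r' \<omega> - T) 0 \<partial>M) - (\<integral>\<omega>. max (qvar r \<omega> - T) 0 \<partial>M))"
    using intm by simp
  finally show ?thesis .
qed

text \<open>The right side is a difference of values at the two ends, so the one-step bounds
  telescope and the number of steps does not enter.\<close>

lemma damped_bound:
  assumes "0 \<le> r" "r \<le> r'"
  shows "norm ((\<integral>\<omega>. damped l T r' \<omega> \<partial>M) - (\<integral>\<omega>. damped l T r \<omega> \<partial>M))
    \<le> l\<^sup>2 / 2 * ((\<integral>\<omega>. max (qvar r' \<omega> - T) 0 \<partial>M) - (\<integral>\<omega>. max (qvar r \<omega> - T) 0 \<partial>M))"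
proof (rule interval_chain[of "a ` J" r r'])
  fix s s' s''
  assume 1: "norm ((\<integral>\<omega>. damped l T s' \<omega> \<partial>M) - (\<integral>\<omega>. damped l T s \<omega> \<partial>M))
    \<le> l\<^sup>2 / 2 * ((\<integral>\<omega>. max (qvar s' \<omega> - T) 0 \<partial>M) - (\<integral>\<omega>. max (qvar s \<omega> - T) 0 \<partial>M))"
   and 2: "norm ((\<integral>\<omega>. damped l T s'' \<omega> \<partial>M) - (\<integral>\<omega>. damped l T s' \<omega> \<partial>M))
    \<le> l\<^sup>2 / 2 * ((\<integral>\<omega>. max (qvar s'' \<omega> - T) 0 \<partial>M) - (\<integral>\<omega>. max (qvar s' \<omega> - T) 0 \<partial>M))"
  show "norm ((\<integral>\<omega>. damped l T s'' \<omega> \<partial>M) - (\<integral>\<omega>. damped l T s \<omega> \<partial>M))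
    \<le> l\<^sup>2 / 2 * ((\<integral>\<omega>. max (qvar s'' \<omega> - T) 0 \<partial>M) - (\<integral>\<omega>. max (qvar s \<omega> - T) 0 \<partial>M))"
    using norm_triangle_le[OF add_mono[OF 2 1]] by (simp add: algebra_simps)
next
  fix s s' assume "r \<le> s" "s \<le> s'" "a ` J \<inter> {s<..<s'} = {}"
  then show "norm ((\<integral>\<omega>. damped l T s' \<omega> \<partial>M) - (\<integral>\<omega>. damped l T s \<omega> \<partial>M))
    \<le> l\<^sup>2 / 2 * ((\<integral>\<omega>. max (qvar s' \<omega> - T) 0 \<partial>M) - (\<integral>\<omega>. max (qvar s \<omega> - T) 0 \<partial>M))"
    using assms(1) by (intro damped_step) auto
qed (use finite_J assms in auto)

text \<open>Time and level coincide here. Between 0 and \<open>T\<close> the mean of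
  \<open>damped\<close> moves by at most \<open>l\<^sup>2 / 2\<close> times the expected excess of
  the quadratic variation over \<open>T\<close>; dropping the residual damping at \<open>T\<close>
  costs the same multiple of the expected deficit.\<close>

lemma wint_char_bound:
  assumes "0 \<le> T"
  shows "norm ((CLINT \<omega>|M. iexp (l * wint T \<omega>)) - complex_of_real (exp (- (l\<^sup>2 * T) / 2)))
    \<le> l\<^sup>2 / 2 * (\<integral>\<omega>. \<bar>qvar T \<omega> - T\<bar> \<partial>M)"
proof -
  have [measurable]: "wint T \<in> borel_measurable M" "qvar T \<in> borel_measurable M"
    using assms by (auto intro: measurable_F_M measurable_wint measurable_qvar)
  have strip0: "strip j 0 0 = {}" for j by (simp add: strip_def)
  have q0: "qvar 0 \<omega> = 0" for \<omega> by (simp add: qvar_def strip0)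
  have meas0: "damped l T 0 \<in> borel_measurable M"
    using integrable_damped[of 0] by (rule borel_measurable_integrable) simp
  \<comment> \<open>At time 0 only \<open>W {}\<close> enters, so the full damping is all that is
    left.\<close>
  have "(\<integral>\<omega>. damped l T 0 \<omega> \<partial>M) = (\<integral>\<omega>. complex_of_real (exp (- (l\<^sup>2 * T) / 2)) \<partial>M)"
  proof (rule integral_cong_AE)
    show "AE \<omega> in M. damped l T 0 \<omega> = complex_of_real (exp (- (l\<^sup>2 * T) / 2))"
      using W_empty_AE by eventually_elim (use assms in \<open>simp add: damped_def q0 wint_def strip0\<close>)
  qed (use meas0 in auto)
  also have "\<dots> = complex_of_real (exp (- (l\<^sup>2 * T) / 2))" by (simp add: prob_space)
  finally have d0: "(\<integral>\<omega>. damped l T 0 \<omega> \<partial>M) = complex_of_real (exp (- (l\<^sup>2 * T) / 2))" .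
  have intm: "integrable M (\<lambda>\<omega>. max (qvar T \<omega> - T) 0)" "integrable M (\<lambda>\<omega>. T - min (qvar T \<omega>) T)"
    by (intro integrable_max integrable_min Bochner_Integration.integrable_diff integrable_qvar; simp)+
  have int: "integrable M (\<lambda>\<omega>. iexp (l * wint T \<omega>))"
    by (rule integrable_const_bound[where B=1]) auto
  have 1: "norm ((\<integral>\<omega>. damped l T T \<omega> \<partial>M) - complex_of_real (exp (- (l\<^sup>2 * T) / 2)))
      \<le> l\<^sup>2 / 2 * (\<integral>\<omega>. max (qvar T \<omega> - T) 0 \<partial>M)"
    using damped_bound[of 0 T l T] assms by (simp add: d0 q0)
  have "norm ((CLINT \<omega>|M. iexp (l * wint T \<omega>)) - (\<integral>\<omega>. damped l T T \<omega> \<partial>M))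
     = norm (\<integral>\<omega>. iexp (l * wint T \<omega>) - damped l T T \<omega> \<partial>M)"
    using int integrable_damped[OF assms] by simp
  also have "\<dots> \<le> (\<integral>\<omega>. l\<^sup>2 / 2 * (T - min (qvar T \<omega>) T) \<partial>M)"
  proof (rule integral_norm_le_integral)
    show "integrable M (\<lambda>\<omega>. iexp (l * wint T \<omega>) - damped l T T \<omega>)"
      by (rule Bochner_Integration.integrable_diff[OF int integrable_damped[OF assms]])
    show "integrable M (\<lambda>\<omega>. l\<^sup>2 / 2 * (T - min (qvar T \<omega>) T))"
      by (rule integrable_mult_right) (rule intm)
    fix \<omega>
    let ?y = "l\<^sup>2 / 2 * (T - min (qvar T \<omega>) T)"
    have "iexp (l * wint T \<omega>) - damped l T T \<omega> = iexp (l * wint T \<omega>) * complex_of_real (exp (- 0) - exp (- ?y))"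
      unfolding damped_def of_real_diff by (simp add: algebra_simps)
    then have "norm (iexp (l * wint T \<omega>) - damped l T T \<omega>) = \<bar>exp (- 0) - exp (- ?y)\<bar>"
      by (simp only: norm_mult norm_exp_i_times norm_of_real mult_1_left)
    also have "\<dots> \<le> \<bar>0 - ?y\<bar>" by (intro exp_minus_lipschitz) auto
    finally show "norm (iexp (l * wint T \<omega>) - damped l T T \<omega>) \<le> ?y" by simp
  qed
  also have "\<dots> = l\<^sup>2 / 2 * (\<integral>\<omega>. T - min (qvar T \<omega>) T \<partial>M)" by (rule integral_mult_right_zero)
  finally have 2: "norm ((CLINT \<omega>|M. iexp (l * wint T \<omega>)) - (\<integral>\<omega>. damped l T T \<omega> \<partial>M))
     \<le> l\<^sup>2 / 2 * (\<integral>\<omega>. T - min (qvar T \<omega>) T \<partial>M)" .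
  have "(\<integral>\<omega>. \<bar>qvar T \<omega> - T\<bar> \<partial>M) = (\<integral>\<omega>. (T - min (qvar T \<omega>) T) + max (qvar T \<omega> - T) 0 \<partial>M)"
    by (intro Bochner_Integration.integral_cong) (auto simp: max_def min_def)
  also have "\<dots> = (\<integral>\<omega>. T - min (qvar T \<omega>) T \<partial>M) + (\<integral>\<omega>. max (qvar T \<omega> - T) 0 \<partial>M)"
    using intm by (intro Bochner_Integration.integral_add)
  finally show ?thesis
    using norm_triangle_le[OF add_mono[OF 2 1]] by (simp add: algebra_simps)
qed

end

section \<open>Integrands of constant quadratic variation\<close>

text \<open>\<open>K\<close> may blow up as \<open>\<epsilon>\<close> decreases but does not depend
  on \<open>k\<close>: first \<open>k\<close> tends to infinity, then \<open>\<epsilon>\<close> to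
  0. Values in \<open>ennreal\<close> allow \<open>\<delta>\<close> to be infinite at first.\<close>

lemma small_limit:
  fixes c :: "nat \<Rightarrow> real" and \<delta> :: "nat \<Rightarrow> ennreal"
  assumes bound: "\<And>\<epsilon>. 0 < \<epsilon> \<Longrightarrow> \<exists>K. \<forall>k. ennreal (c k) \<le> ennreal K * \<delta> k + ennreal (\<epsilon> * T)"
    and \<delta>: "\<delta> \<longlonglongrightarrow> 0" and c: "\<And>k. 0 \<le> c k" and "0 \<le> T"
  shows "c \<longlonglongrightarrow> 0"
proof (rule order_tendstoI)
  show "\<forall>\<^sub>F k in sequentially. e < c k" if "e < 0" for e
    using that c by (intro always_eventually allI) (auto intro: less_le_trans)
next
  fix e :: real assume "0 < e"
  \<comment> \<open>\<open>T + 1\<close> instead of \<open>T\<close> covers the case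
    \<open>T = 0\<close>.\<close>
  define \<epsilon> where "\<epsilon> = e / (2 * (T + 1))"
  have "0 < \<epsilon>" "\<epsilon> * T \<le> e / 2" using \<open>0 < e\<close> \<open>0 \<le> T\<close> by (auto simp: \<epsilon>_def field_simps)
  from bound[OF this(1)] obtain K where K: "\<And>k. ennreal (c k) \<le> ennreal K * \<delta> k + ennreal (\<epsilon> * T)" by blast
  have "(\<lambda>k. ennreal K * \<delta> k) \<longlonglongrightarrow> ennreal K * 0"
    by (intro ennreal_tendsto_cmult \<delta>) auto
  then have "\<forall>\<^sub>F k in sequentially. ennreal K * \<delta> k < ennreal (e / 2)"
    using \<open>0 < e\<close> by (intro order_tendstoD) auto
  then show "\<forall>\<^sub>F k in sequentially. c k < e"
  proof eventually_elim
    case (elim k)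
    then obtain r where r: "0 \<le> r" "ennreal K * \<delta> k = ennreal r" "r < e / 2"
      by (cases "ennreal K * \<delta> k" rule: ennreal_cases) (auto simp: ennreal_less_iff)
    have "ennreal (c k) \<le> ennreal (r + \<epsilon> * T)"
      using K[of k] r \<open>0 < \<epsilon>\<close> \<open>0 \<le> T\<close> by (simp add: ennreal_plus)
    then have "c k \<le> r + \<epsilon> * T"
      using r \<open>0 < \<epsilon>\<close> \<open>0 \<le> T\<close> by (subst (asm) ennreal_le_iff) auto
    then show ?case using r \<open>\<epsilon> * T \<le> e / 2\<close> by simp
  qed
qed

lemma norm_iexp_diff_le: "norm (iexp x - iexp y) \<le> \<bar>x - y\<bar>"
proof -
  have "iexp x - iexp y = iexp y * (iexp (x - y) - 1)"
    by (simp add: right_diff_distrib exp_add[symmetric] algebra_simps)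
  then show ?thesis
    using iexp_approx1[of "x - y" 0] by (simp only: norm_mult norm_exp_i_times) simp
qed

text \<open>Young's inequality for the cross term 2 f (g - f). Being linear in the two squares, it
  can be integrated directly and turns L2 closeness of integrands into L1 closeness of their
  squares.\<close>

lemma square_diff_bound:
  fixes f g \<epsilon> :: real
  assumes "0 < \<epsilon>"
  shows "\<bar>g\<^sup>2 - f\<^sup>2\<bar> \<le> (1 + 1 / \<epsilon>) * (g - f)\<^sup>2 + \<epsilon> * f\<^sup>2"
proof -
  define d where "d = g - f"
  have "0 \<le> \<epsilon> * (f + d / \<epsilon>)\<^sup>2" "0 \<le> \<epsilon> * (f - d / \<epsilon>)\<^sup>2" using assms by auto
  moreover have "\<epsilon> * (f + d / \<epsilon>)\<^sup>2 = \<epsilon> * f\<^sup>2 + 2 * f * d + d\<^sup>2 / \<epsilon>" "\<epsilon> * (f - d / \<epsilon>)\<^sup>2 = \<epsilon> * f\<^sup>2 - 2 * f * d + d\<^sup>2 / \<epsilon>"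
    using assms by (simp_all add: power2_eq_square field_simps)
  moreover have "g\<^sup>2 - f\<^sup>2 = d\<^sup>2 + 2 * f * d" by (simp add: d_def power2_eq_square algebra_simps)
  moreover have "(1 + 1 / \<epsilon>) * d\<^sup>2 = d\<^sup>2 + d\<^sup>2 / \<epsilon>" by (simp add: algebra_simps)
  moreover have "0 \<le> d\<^sup>2" by simp
  ultimately show ?thesis unfolding d_def[symmetric] abs_le_iff by linarith
qed

section \<open>From elementary integrands to their L2 limits\<close>

context white_noise_space
begin

abbreviation slab :: "real \<Rightarrow> (real \<times> real) measure" where
  "slab t \<equiv> restrict_space lborel (UNIV \<times> {0..t})"

lemma sets_slab: "UNIV \<times> {0..t} \<in> sets (borel :: (real \<times> real) measure)"
  unfolding borel_prod[symmetric] by auto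

lemma sigma_finite_slab: "sigma_finite_measure (slab t)"
  using sets_slab by (intro sigma_finite_measure_restrict_space) (auto intro: lborel.sigma_finite_measure_axioms)

text \<open>List positions serve as the index set, so repeated entries stay distinct, and the
  pathwise integral of the squared integrand is identified with \<open>qvar t\<close>.\<close>

lemma elementary_char_bound:
  assumes S: "elementary F S" and "0 \<le> t"
  shows "norm ((CLINT \<omega>|M. iexp (l * elem_integral W t S \<omega>)) - complex_of_real (exp (- (l\<^sup>2 * t) / 2)))
      \<le> l\<^sup>2 / 2 * (\<integral>\<omega>. \<bar>(\<integral>p. (elem_val S (\<omega>, p))\<^sup>2 \<partial>slab t) - t\<bar> \<partial>M)" (is ?char)
    and "elem_integral W t S \<in> borel_measurable M" (is ?meas)
    and "elem_val S \<in> borel_measurable (M \<Otimes>\<^sub>M slab t)" (is ?val)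
    and "\<And>\<omega>. integrable (slab t) (\<lambda>p. (elem_val S (\<omega>, p))\<^sup>2)" (is "\<And>\<omega>. ?int1 \<omega>")
    and "integrable M (\<lambda>\<omega>. \<bar>(\<integral>p. (elem_val S (\<omega>, p))\<^sup>2 \<partial>slab t) - t\<bar>)" (is ?int2)
proof -
  define \<xi> where "\<xi> j = fst (S ! j)" for j
  define a where "a j = fst (snd (S ! j))" for j
  define b where "b j = fst (snd (snd (S ! j)))" for j
  define A where "A j = snd (snd (snd (S ! j)))" for j
  have nth: "S ! j = (\<xi> j, a j, b j, A j)" for j by (simp add: \<xi>_def a_def b_def A_def)
  have el: "0 \<le> a j \<and> a j \<le> b j \<and> A j \<in> sets borel \<and> emeasure lborel (A j) < \<infinity> \<and>
        \<xi> j \<in> borel_measurable (F (a j)) \<and> (\<exists>C. \<forall>\<omega>\<in>space M. \<bar>\<xi> j \<omega>\<bar> \<le> C)" if "j < length S" for j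
    using S[unfolded elementary_def, rule_format, OF nth_mem[OF that]] by (simp add: nth space_F)
  interpret simple_integrand M F W "{..<length S}" \<xi> a b A
    by unfold_locales (use el in auto)
  have val: "elem_val S (\<omega>, q, s) = (\<Sum>j<length S. \<xi> j \<omega> * indicator (A j) q * indicator {a j<..b j} s)" for \<omega> q s
    by (simp add: elem_val_def sum_list_sum_nth nth atLeast0LessThan)
  have val': "elem_val S = (\<lambda>p. \<Sum>j<length S. \<xi> j (fst p) * indicator (A j) (fst (snd p)) * indicator {a j<..b j} (snd (snd p)))"
    using val by (simp add: fun_eq_iff)
  have eint: "elem_integral W t S \<omega> = (\<Sum>j<length S. \<xi> j \<omega> * W (strip j 0 t) \<omega>)" for \<omega>
  proof -
    \<comment> \<open>As \<open>0 \<le> a j\<close>, restricting to \<open>{0<..t}\<close> loses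
      nothing against \<open>{..t}\<close>; the same fact later reconciles strips with the closed
      slab.\<close>
    have "A j \<times> ({a j<..b j} \<inter> {..t}) = strip j 0 t" if "j < length S" for j
      using el[OF that] by (auto simp: strip_def)
    then show ?thesis by (simp add: elem_integral_def sum_list_sum_nth nth atLeast0LessThan)
  qed
  have [measurable]: "\<xi> j \<in> borel_measurable M" "A j \<in> sets borel" if "j < length S" for j
    using el[OF that] measurable_F_M by auto
  show ?meas
  proof -
    have [measurable]: "W (strip j 0 t) \<in> borel_measurable M" if "j < length S" for j
      using that assms(2) by (intro measurable_W strip_noise_sets) auto
    show ?thesis unfolding eint[abs_def] by measurable
  qed
  show ?val
  proof -
    have "elem_val S \<in> borel_measurable (M \<Otimes>\<^sub>M (borel \<Otimes>\<^sub>M borel))"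
      unfolding val' by measurable
    moreover have "(\<lambda>p. (fst p, snd p)) \<in> measurable (M \<Otimes>\<^sub>M slab t) (M \<Otimes>\<^sub>M (borel \<Otimes>\<^sub>M borel))"
      by (intro measurable_Pair measurable_fst measurable_compose[OF measurable_snd measurable_restrict_space1])
        (simp add: borel_prod)
    ultimately show ?thesis using measurable_compose by fastforce
  qed
  have sq: "indicator (UNIV \<times> {0..t}) p * (elem_val S (\<omega>, p))\<^sup>2
      = (\<Sum>j<length S. \<Sum>k<length S. \<xi> j \<omega> * \<xi> k \<omega> * indicator (strip j 0 t \<inter> strip k 0 t) p)" for \<omega> p
  proof (cases p)
    case (Pair q s)
    define v where "v j = \<xi> j \<omega> * indicator (A j) q * indicator {a j<..b j} s" for j
    have "indicator (UNIV \<times> {0..t}) p * (v j * v k)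
      = \<xi> j \<omega> * \<xi> k \<omega> * indicator (strip j 0 t \<inter> strip k 0 t) p" if "j < length S" "k < length S" for j k
      using el[OF that(1)] el[OF that(2)] by (auto simp: Pair v_def strip_def indicator_def)
    moreover have "(elem_val S (\<omega>, p))\<^sup>2 = (\<Sum>j<length S. \<Sum>k<length S. v j * v k)"
      by (simp only: Pair val v_def power2_eq_square sum_product)
    ultimately show ?thesis by (simp add: sum_distrib_left)
  qed
  have int: "integrable lborel (\<lambda>p. indicator (UNIV \<times> {0..t}) p * (elem_val S (\<omega>, p))\<^sup>2)" for \<omega>
    unfolding sq using strip_Int_finite[of _ _ 0 t]
    by (intro Bochner_Integration.integrable_sum integrable_mult_right integrable_real_indicator)
      (auto simp: less_top)
  then show "?int1 \<omega>" for \<omega>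
    using sets_slab by (subst integrable_restrict_space) auto
  have q: "(\<integral>p. (elem_val S (\<omega>, p))\<^sup>2 \<partial>slab t) = qvar t \<omega>" for \<omega>
  proof -
    have "(\<integral>p. (elem_val S (\<omega>, p))\<^sup>2 \<partial>slab t) = (\<integral>p. indicator (UNIV \<times> {0..t}) p * (elem_val S (\<omega>, p))\<^sup>2 \<partial>lborel)"
      using sets_slab by (subst integral_restrict_space) auto
    also have "\<dots> = (\<Sum>j<length S. \<Sum>k<length S. \<integral>p. \<xi> j \<omega> * \<xi> k \<omega> * indicator (strip j 0 t \<inter> strip k 0 t) p \<partial>lborel)"
      unfolding sq using strip_Int_finite[of _ _ 0 t]
      by (subst Bochner_Integration.integral_sum, (intro Bochner_Integration.integrable_sum integrable_mult_right integrable_real_indicator; auto simp: less_top),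
          intro sum.cong refl Bochner_Integration.integral_sum integrable_mult_right integrable_real_indicator)
         (auto simp: less_top)
    also have "\<dots> = qvar t \<omega>" unfolding qvar_def by simp
    finally show ?thesis .
  qed
  show ?int2
    unfolding q by (intro integrable_abs Bochner_Integration.integrable_diff integrable_qvar) simp
  have "(CLINT \<omega>|M. iexp (l * elem_integral W t S \<omega>)) = (CLINT \<omega>|M. iexp (l * wint t \<omega>))"
  proof (rule integral_cong_AE)
    have [measurable]: "elem_integral W t S \<in> borel_measurable M" "wint t \<in> borel_measurable M"
      using \<open>?meas\<close> assms(2) measurable_F_M[OF measurable_wint] by auto
    show "(\<lambda>\<omega>. iexp (l * elem_integral W t S \<omega>)) \<in> borel_measurable M" "(\<lambda>\<omega>. iexp (l * wint t \<omega>)) \<in> borel_measurable M"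
      by measurable
    show "AE \<omega> in M. iexp (l * elem_integral W t S \<omega>) = iexp (l * wint t \<omega>)"
      using W_empty_AE
    proof eventually_elim
      case (elim \<omega>)
      \<comment> \<open>Full and truncated coefficients differ only for terms starting after
        \<open>t\<close>, which meet an empty strip.\<close>
      have "\<xi> j \<omega> * W (strip j 0 t) \<omega> = coef j t \<omega> * W (strip j 0 t) \<omega>" for j
      proof (cases "a j \<le> t")
        case False
        then have "strip j 0 t = {}" by (auto simp: strip_def)
        then show ?thesis using elim by simp
      qed (simp add: coef_def)
      then show ?case by (simp only: eint wint_def)
    qed
  qed
  then show ?char using wint_char_bound[OF assms(2)] by (simp only: q)
qed

text \<open>\<open>unit\<close> is required on every path and not just in the mean: a random
  quadratic variation would in general destroy normality. It makes the quadratic variations of the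
  approximants converge to \<open>t\<close> in L1, so the error in
  \<open>elementary_char_bound\<close> vanishes.\<close>

theorem has_stochastic_integral_normal:
  assumes I: "has_stochastic_integral M F W t f I" and "0 \<le> t"
    and unit: "\<And>\<omega>. \<omega> \<in> space M \<Longrightarrow> (\<integral>\<^sup>+p. ennreal ((f (\<omega>, p))\<^sup>2) \<partial>slab t) = ennreal t"
  shows "scaled_normal M I (sqrt t)"
proof -
  let ?N = "M \<Otimes>\<^sub>M slab t"
  from I obtain S where f [measurable]: "f \<in> borel_measurable ?N" and I_meas [measurable]: "I \<in> borel_measurable M"
    and S: "\<And>k. elementary F (S k)"
    and lim_val: "(\<lambda>k. \<integral>\<^sup>+p. ennreal ((elem_val (S k) p - f p)\<^sup>2) \<partial>?N) \<longlonglongrightarrow> 0"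
    and lim_int: "(\<lambda>k. \<integral>\<^sup>+\<omega>. ennreal ((elem_integral W t (S k) \<omega> - I \<omega>)\<^sup>2) \<partial>M) \<longlonglongrightarrow> 0"
    unfolding has_stochastic_integral_def Let_def by blast
  note elem = elementary_char_bound[OF S assms(2)]
  note [measurable] = elem(2,3)
  define c where "c k = (\<integral>\<omega>. \<bar>(\<integral>p. (elem_val (S k) (\<omega>, p))\<^sup>2 \<partial>slab t) - t\<bar> \<partial>M)" for k
  interpret slab: sigma_finite_measure "slab t" by (rule sigma_finite_slab)
  have sec: "(\<lambda>p. h (\<omega>, p)) \<in> borel_measurable (slab t)" if "h \<in> borel_measurable ?N" "\<omega> \<in> space M" for h :: "_ \<Rightarrow> real" and \<omega>
    using measurable_compose[OF measurable_Pair1'[OF that(2)] that(1)] .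
  have c_lim: "c \<longlonglongrightarrow> 0"
  proof (rule small_limit[OF _ lim_val _ assms(2)])
    show "0 \<le> c k" for k unfolding c_def by simp
    fix \<epsilon> :: real assume "0 < \<epsilon>"
    have "ennreal (c k) \<le> ennreal (1 + 1 / \<epsilon>) * (\<integral>\<^sup>+p. ennreal ((elem_val (S k) p - f p)\<^sup>2) \<partial>?N) + ennreal (\<epsilon> * t)" for k
    proof -
      let ?g = "elem_val (S k)"
      have "ennreal (c k) = (\<integral>\<^sup>+\<omega>. ennreal \<bar>(\<integral>p. (?g (\<omega>, p))\<^sup>2 \<partial>slab t) - t\<bar> \<partial>M)"
        unfolding c_def by (intro nn_integral_eq_integral[symmetric] elem(5)) auto
      also have "\<dots> \<le> (\<integral>\<^sup>+\<omega>. (\<integral>\<^sup>+p. ennreal \<bar>(?g (\<omega>, p))\<^sup>2 - (f (\<omega>, p))\<^sup>2\<bar> \<partial>slab t) \<partial>M)"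
      proof (rule nn_integral_mono)
        fix \<omega> assume \<omega>: "\<omega> \<in> space M"
        note [measurable] = sec[OF f \<omega>]
        have int: "integrable (slab t) (\<lambda>p. (f (\<omega>, p))\<^sup>2)"
          by (rule integrableI_nonneg) (auto simp: unit[OF \<omega>])
        have "(\<integral>p. (f (\<omega>, p))\<^sup>2 \<partial>slab t) = t"
          using nn_integral_eq_integral[OF int] unit[OF \<omega>] assms(2) by simp
        then have "(\<integral>p. (?g (\<omega>, p))\<^sup>2 \<partial>slab t) - t = (\<integral>p. (?g (\<omega>, p))\<^sup>2 - (f (\<omega>, p))\<^sup>2 \<partial>slab t)"
          using int elem(4) by simp
        then show "ennreal \<bar>(\<integral>p. (?g (\<omega>, p))\<^sup>2 \<partial>slab t) - t\<bar> \<le> (\<integral>\<^sup>+p. ennreal \<bar>(?g (\<omega>, p))\<^sup>2 - (f (\<omega>, p))\<^sup>2\<bar> \<partial>slab t)"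
          using integral_norm_bound_ennreal[OF Bochner_Integration.integrable_diff[OF elem(4) int]] by simp
      qed
      \<comment> \<open>After integration the \<open>\<epsilon>\<close> part is exactly
        \<open>\<epsilon> * t\<close> by \<open>unit\<close>, for every approximant; the rest is a
        multiple of the given L2 distance.\<close>
      also have "\<dots> \<le> (\<integral>\<^sup>+\<omega>. (\<integral>\<^sup>+p. ennreal (1 + 1 / \<epsilon>) * ennreal ((?g (\<omega>, p) - f (\<omega>, p))\<^sup>2) + ennreal \<epsilon> * ennreal ((f (\<omega>, p))\<^sup>2) \<partial>slab t) \<partial>M)"
      proof (intro nn_integral_mono)
        fix \<omega> p
        show "ennreal \<bar>(?g (\<omega>, p))\<^sup>2 - (f (\<omega>, p))\<^sup>2\<bar>
          \<le> ennreal (1 + 1 / \<epsilon>) * ennreal ((?g (\<omega>, p) - f (\<omega>, p))\<^sup>2) + ennreal \<epsilon> * ennreal ((f (\<omega>, p))\<^sup>2)"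
          using ennreal_leI[OF square_diff_bound[OF \<open>0 < \<epsilon>\<close>, of "?g (\<omega>, p)" "f (\<omega>, p)"]] \<open>0 < \<epsilon>\<close>
          by (simp add: ennreal_plus ennreal_mult del: ennreal_leI)
      qed
      also have "\<dots> = (\<integral>\<^sup>+\<omega>. ennreal (1 + 1 / \<epsilon>) * (\<integral>\<^sup>+p. ennreal ((?g (\<omega>, p) - f (\<omega>, p))\<^sup>2) \<partial>slab t) + ennreal \<epsilon> * ennreal t \<partial>M)"
      proof (rule nn_integral_cong)
        fix \<omega> assume \<omega>: "\<omega> \<in> space M"
        note [measurable] = sec[OF f \<omega>] sec[OF elem(3) \<omega>]
        show "(\<integral>\<^sup>+p. ennreal (1 + 1 / \<epsilon>) * ennreal ((?g (\<omega>, p) - f (\<omega>, p))\<^sup>2) + ennreal \<epsilon> * ennreal ((f (\<omega>, p))\<^sup>2) \<partial>slab t)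
          = ennreal (1 + 1 / \<epsilon>) * (\<integral>\<^sup>+p. ennreal ((?g (\<omega>, p) - f (\<omega>, p))\<^sup>2) \<partial>slab t) + ennreal \<epsilon> * ennreal t"
          by (simp add: nn_integral_add nn_integral_cmult unit[OF \<omega>])
      qed
      also have "\<dots> = ennreal (1 + 1 / \<epsilon>) * (\<integral>\<^sup>+\<omega>. (\<integral>\<^sup>+p. ennreal ((?g (\<omega>, p) - f (\<omega>, p))\<^sup>2) \<partial>slab t) \<partial>M) + ennreal \<epsilon> * ennreal t"
        by (simp add: nn_integral_add nn_integral_cmult emeasure_space_1)
      also have "(\<integral>\<^sup>+\<omega>. (\<integral>\<^sup>+p. ennreal ((?g (\<omega>, p) - f (\<omega>, p))\<^sup>2) \<partial>slab t) \<partial>M) = (\<integral>\<^sup>+p. ennreal ((?g p - f p)\<^sup>2) \<partial>?N)"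
        by (rule slab.nn_integral_fst) measurable
      also have "ennreal \<epsilon> * ennreal t = ennreal (\<epsilon> * t)"
        using \<open>0 < \<epsilon>\<close> assms(2) by (simp add: ennreal_mult)
      finally show ?thesis .
    qed
    then show "\<exists>K. \<forall>k. ennreal (c k) \<le> ennreal K * (\<integral>\<^sup>+p. ennreal ((elem_val (S k) p - f p)\<^sup>2) \<partial>?N) + ennreal (\<epsilon> * t)"
      by blast
  qed
  show ?thesis
  proof (rule scaled_normalI[OF prob_space_axioms I_meas])
    fix l :: real
    define d where "d k = norm ((CLINT \<omega>|M. iexp (l * elem_integral W t (S k) \<omega>)) - (CLINT \<omega>|M. iexp (l * I \<omega>)))" for k
    have int: "integrable M (\<lambda>\<omega>. iexp (l * X \<omega>))" if [measurable]: "X \<in> borel_measurable M" for X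
      by (rule integrable_const_bound[where B=1]) auto
    \<comment> \<open>The bound |y| <= y^2 / eps + eps with y = l (X - I) is integrated over a
      probability space, so 1 takes the role of \<open>T\<close> in
      \<open>small_limit\<close>.\<close>
    have d_lim: "d \<longlonglongrightarrow> 0"
    proof (rule small_limit[OF _ lim_int])
      show "0 \<le> d k" for k unfolding d_def by simp
      fix \<epsilon> :: real assume "0 < \<epsilon>"
      have "ennreal (d k) \<le> ennreal (l\<^sup>2 / \<epsilon>) * (\<integral>\<^sup>+\<omega>. ennreal ((elem_integral W t (S k) \<omega> - I \<omega>)\<^sup>2) \<partial>M) + ennreal (\<epsilon> * 1)" for k
      proof -
        let ?X = "elem_integral W t (S k)"
        have "d k = norm (\<integral>\<omega>. iexp (l * ?X \<omega>) - iexp (l * I \<omega>) \<partial>M)"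
          unfolding d_def using int[OF elem(2)] int[OF I_meas] by simp
        then have "ennreal (d k) \<le> (\<integral>\<^sup>+\<omega>. ennreal (norm (iexp (l * ?X \<omega>) - iexp (l * I \<omega>))) \<partial>M)"
          using integral_norm_bound_ennreal[OF Bochner_Integration.integrable_diff[OF int[OF elem(2)] int[OF I_meas]]]
          by (simp only:)
        also have "\<dots> \<le> (\<integral>\<^sup>+\<omega>. ennreal (l\<^sup>2 / \<epsilon>) * ennreal ((?X \<omega> - I \<omega>)\<^sup>2) + ennreal \<epsilon> \<partial>M)"
        proof (rule nn_integral_mono)
          fix \<omega>
          have "2 * \<bar>y\<bar> \<le> y\<^sup>2 / \<epsilon> + \<epsilon>" for y
            using zero_le_power2[of "\<bar>y\<bar> - \<epsilon>"] \<open>0 < \<epsilon>\<close> by (simp add: power2_eq_square field_simps)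
          then have "\<bar>y\<bar> \<le> y\<^sup>2 / \<epsilon> + \<epsilon>" for y
            using abs_ge_zero[of y] by (smt (verit))
          from this[of "l * (?X \<omega> - I \<omega>)"]
          have "\<bar>l * ?X \<omega> - l * I \<omega>\<bar> \<le> l\<^sup>2 / \<epsilon> * (?X \<omega> - I \<omega>)\<^sup>2 + \<epsilon>"
            by (simp only: right_diff_distrib[symmetric] power_mult_distrib times_divide_eq_left)
          with norm_iexp_diff_le[of "l * ?X \<omega>" "l * I \<omega>"]
          have "norm (iexp (l * ?X \<omega>) - iexp (l * I \<omega>)) \<le> l\<^sup>2 / \<epsilon> * (?X \<omega> - I \<omega>)\<^sup>2 + \<epsilon>"
            by (rule order_trans)
          from ennreal_leI[OF this]
          show "ennreal (norm (iexp (l * ?X \<omega>) - iexp (l * I \<omega>))) \<le> ennreal (l\<^sup>2 / \<epsilon>) * ennreal ((?X \<omega> - I \<omega>)\<^sup>2) + ennreal \<epsilon>"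
            using \<open>0 < \<epsilon>\<close> by (simp only: ennreal_plus ennreal_mult zero_le_power2 less_imp_le divide_nonneg_pos mult_nonneg_nonneg)
        qed
        also have "\<dots> = ennreal (l\<^sup>2 / \<epsilon>) * (\<integral>\<^sup>+\<omega>. ennreal ((?X \<omega> - I \<omega>)\<^sup>2) \<partial>M) + ennreal (\<epsilon> * 1)"
          by (simp add: nn_integral_add nn_integral_cmult emeasure_space_1)
        finally show ?thesis .
      qed
      then show "\<exists>K. \<forall>k. ennreal (d k) \<le> ennreal K * (\<integral>\<^sup>+\<omega>. ennreal ((elem_integral W t (S k) \<omega> - I \<omega>)\<^sup>2) \<partial>M) + ennreal (\<epsilon> * 1)"
        by blast
    qed simp
    let ?e = "complex_of_real (exp (- (l\<^sup>2 * t) / 2))"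
    have "norm ((CLINT \<omega>|M. iexp (l * I \<omega>)) - ?e) \<le> d k + l\<^sup>2 / 2 * c k" for k
    proof -
      have "norm ((CLINT \<omega>|M. iexp (l * elem_integral W t (S k) \<omega>)) - ?e) \<le> l\<^sup>2 / 2 * c k"
        unfolding c_def by (rule elem(1))
      moreover have "norm (y - z) \<le> norm (x - y) + norm (x - z)" for x y z :: complex
        using norm_triangle_ineq4[of "x - z" "x - y"] by simp
      ultimately show ?thesis unfolding d_def by (meson add_left_mono order_trans)
    qed
    moreover have "(\<lambda>k. d k + l\<^sup>2 / 2 * c k) \<longlonglongrightarrow> 0 + l\<^sup>2 / 2 * 0"
      by (intro tendsto_intros c_lim d_lim)
    ultimately have "norm ((CLINT \<omega>|M. iexp (l * I \<omega>)) - ?e) \<le> 0"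
      by (intro LIMSEQ_le_const) auto
    then show "(CLINT \<omega>|M. iexp (l * I \<omega>)) = complex_of_real (exp (- (l\<^sup>2 * (sqrt t)\<^sup>2) / 2))"
      using assms(2) by simp
  qed
qed

end

section \<open>Moments of the flow\<close>

lemma abs_prod_le_power:
  fixes y :: "'i \<Rightarrow> real"
  assumes "finite J" "\<And>i. i \<in> J \<Longrightarrow> \<bar>y i\<bar> \<le> s"
  shows "\<bar>\<Prod>i\<in>J. y i\<bar> \<le> s ^ card J"
  using prod_mono[of J "\<lambda>i. \<bar>y i\<bar>" "\<lambda>_. s"] assms by (simp add: abs_prod)

text \<open>Factors are replaced by \<open>w\<close> one at a time; each replacement costs one
  difference, the other \<open>card J - 1\<close> factors being bounded by \<open>s\<close>.\<close>

lemma prod_minus_power_bound: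
  fixes y :: "'i \<Rightarrow> real"
  assumes "finite J" "\<And>i. i \<in> J \<Longrightarrow> \<bar>y i\<bar> \<le> s" "\<bar>w\<bar> \<le> s"
  shows "\<bar>(\<Prod>i\<in>J. y i) - w ^ card J\<bar> \<le> (\<Sum>i\<in>J. \<bar>y i - w\<bar>) * s ^ (card J - 1)"
  using assms(1,2)
proof (induction J rule: finite_induct)
  case (insert i J)
  have "0 \<le> s" using assms(3) by linarith
  have "\<bar>(\<Prod>i\<in>insert i J. y i) - w ^ card (insert i J)\<bar>
      = \<bar>(y i - w) * (\<Prod>i\<in>J. y i) + w * ((\<Prod>i\<in>J. y i) - w ^ card J)\<bar>"
    using insert by (simp add: algebra_simps)
  also have "\<dots> \<le> \<bar>y i - w\<bar> * \<bar>\<Prod>i\<in>J. y i\<bar> + \<bar>w\<bar> * \<bar>(\<Prod>i\<in>J. y i) - w ^ card J\<bar>"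
    by (metis abs_mult abs_triangle_ineq)
  also have "\<dots> \<le> \<bar>y i - w\<bar> * s ^ card J + s * ((\<Sum>i\<in>J. \<bar>y i - w\<bar>) * s ^ (card J - 1))"
    using insert assms(3) \<open>0 \<le> s\<close> by (intro add_mono mult_mono mult_left_mono abs_prod_le_power insert.IH) auto
  also have "s * ((\<Sum>i\<in>J. \<bar>y i - w\<bar>) * s ^ (card J - 1)) = (\<Sum>i\<in>J. \<bar>y i - w\<bar>) * s ^ card J"
  \<comment> \<open>For empty \<open>J\<close> the truncated exponent is 0 instead of -1, but then
    the sum vanishes.\<close>
  proof (cases "J = {}")
    case False
    then have "card J = Suc (card J - 1)" using insert.hyps by (simp add: card_gt_0_iff)
    then show ?thesis by (metis mult.left_commute power_Suc)
  qed simp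
  finally show ?case using insert.hyps by (simp add: algebra_simps)
qed simp

text \<open>A weighted arithmetic-geometric mean inequality without sharp constant;
  \<open>moment_rate\<close> chooses the weight.\<close>

lemma le_add_square_divide:
  fixes a \<theta> :: real
  assumes "0 < \<theta>"
  shows "a \<le> \<theta> + a\<^sup>2 / \<theta>"
proof (cases "a \<le> \<theta>")
  case False
  then have "\<theta> * a \<le> a * a" using assms by (intro mult_right_mono) auto
  then have "a \<le> a\<^sup>2 / \<theta>" using assms by (simp add: power2_eq_square pos_le_divide_eq mult.commute)
  then show ?thesis using assms by simp
qed (use assms in \<open>simp add: add_increasing2\<close>)

text \<open>Every term is at most the largest one. The constant is crude, but it depends only on
  \<open>card J\<close> and \<open>p\<close>.\<close>

lemma sum_power_le:
  fixes f :: "'i \<Rightarrow> real"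
  assumes "finite J" "J \<noteq> {}" "\<And>i. i \<in> J \<Longrightarrow> 0 \<le> f i"
  shows "(\<Sum>i\<in>J. f i) ^ p \<le> real (card J) ^ p * (\<Sum>i\<in>J. f i ^ p)"
proof -
  have "Max (f ` J) \<in> f ` J" using assms by (intro Max_in) auto
  then obtain j where j: "j \<in> J" "f j = Max (f ` J)" by auto
  then have le: "f i \<le> f j" if "i \<in> J" for i using assms that by auto
  have "(\<Sum>i\<in>J. f i) \<le> real (card J) * f j" using le by (rule sum_bounded_above)
  then have "(\<Sum>i\<in>J. f i) ^ p \<le> (real (card J) * f j) ^ p"
    using assms by (intro power_mono sum_nonneg) auto
  also have "\<dots> = real (card J) ^ p * f j ^ p" by (rule power_mult_distrib)
  also have "\<dots> \<le> real (card J) ^ p * (\<Sum>i\<in>J. f i ^ p)"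
    using j assms by (intro mult_left_mono member_le_sum) auto
  finally show ?thesis .
qed

lemma (in scaled_normal) integrable_abs_power: "integrable M (\<lambda>\<omega>. \<bar>X \<omega>\<bar> ^ p)"
  using integrable_abs[OF integrable_power[of p]] by (simp add: power_abs)

lemma (in scaled_normal) integral_abs_power:
  "(\<integral>\<omega>. \<bar>X \<omega>\<bar> ^ p \<partial>M) = \<bar>\<sigma>\<bar> ^ p * (\<integral>z. \<bar>z\<bar> ^ p \<partial>std_normal_distribution)"
proof -
  have "(\<integral>\<omega>. \<bar>X \<omega>\<bar> ^ p \<partial>M) = (\<integral>z. \<bar>z\<bar> ^ p \<partial>distr M borel X)"
    by (subst integral_distr) auto
  also have "\<dots> = (\<integral>z. \<bar>\<sigma> * z\<bar> ^ p \<partial>std_normal_distribution)"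
    unfolding distr_X by (subst integral_distr) auto
  finally show ?thesis by (simp add: power_mult_distrib abs_mult)
qed

lemma (in scaled_normal) normalized:
  assumes "\<sigma> \<noteq> 0" shows "scaled_normal M (\<lambda>\<omega>. X \<omega> / \<sigma>) 1"
proof
  have "distr M borel (\<lambda>\<omega>. X \<omega> / \<sigma>) = distr (distr M borel X) borel (\<lambda>z. z / \<sigma>)"
    by (subst distr_distr) (auto simp: comp_def)
  also have "\<dots> = distr std_normal_distribution borel (\<lambda>z. 1 * z)"
    unfolding distr_X using assms by (subst distr_distr) (auto simp: comp_def intro!: distr_cong)
  finally show "distr M borel (\<lambda>\<omega>. X \<omega> / \<sigma>) = distr std_normal_distribution borel (\<lambda>z. 1 * z)" .
qed simp

text \<open>Only the marginal laws of the \<open>Z i\<close> are known, so the power of the sum is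
  first split into powers of single terms.\<close>

lemma scaled_normal_moment_bound:
  fixes Z :: "'i \<Rightarrow> 'a \<Rightarrow> real"
  assumes J: "finite J" "J \<noteq> {}" and Z: "\<And>i. scaled_normal M (Z i) \<sigma>"
    and "finite_measure M"
  shows "integrable M (\<lambda>\<omega>. (\<Sum>i\<in>J. \<bar>u i\<bar> + \<bar>Z i \<omega>\<bar>) ^ p)" (is ?int)
    and "(\<integral>\<omega>. (\<Sum>i\<in>J. \<bar>u i\<bar> + \<bar>Z i \<omega>\<bar>) ^ p \<partial>M) \<le> real (card J) ^ p *
      (\<Sum>i\<in>J. 2 ^ p * (\<bar>u i\<bar> ^ p * measure M (space M) + \<bar>\<sigma>\<bar> ^ p * (\<integral>z. \<bar>z\<bar> ^ p \<partial>std_normal_distribution)))" (is ?le)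
proof -
  interpret finite_measure M by fact
  have [measurable]: "Z i \<in> borel_measurable M" for i using Z by (simp add: scaled_normal_def)
  let ?g = "\<lambda>\<omega>. real (card J) ^ p * (\<Sum>i\<in>J. 2 ^ p * (\<bar>u i\<bar> ^ p + \<bar>Z i \<omega>\<bar> ^ p))"
  have g: "(\<Sum>i\<in>J. \<bar>u i\<bar> + \<bar>Z i \<omega>\<bar>) ^ p \<le> ?g \<omega>" for \<omega>
  proof -
    have "(\<Sum>i\<in>J. \<bar>u i\<bar> + \<bar>Z i \<omega>\<bar>) ^ p \<le> real (card J) ^ p * (\<Sum>i\<in>J. (\<bar>u i\<bar> + \<bar>Z i \<omega>\<bar>) ^ p)"
      using J by (intro sum_power_le) auto
    \<comment> \<open>The two-term case of \<open>sum_power_le\<close>, with \<open>bool\<close> as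
      index set.\<close>
    also have "(\<bar>u i\<bar> + \<bar>Z i \<omega>\<bar>) ^ p \<le> 2 ^ p * (\<bar>u i\<bar> ^ p + \<bar>Z i \<omega>\<bar> ^ p)" for i
      using sum_power_le[of "UNIV :: bool set" "\<lambda>b. if b then \<bar>u i\<bar> else \<bar>Z i \<omega>\<bar>" p]
      by (simp add: UNIV_bool add.commute)
    then have "real (card J) ^ p * (\<Sum>i\<in>J. (\<bar>u i\<bar> + \<bar>Z i \<omega>\<bar>) ^ p) \<le> ?g \<omega>"
      by (intro mult_left_mono sum_mono) auto
    finally show ?thesis .
  qed
  have int_g: "integrable M ?g"
    using scaled_normal.integrable_abs_power[OF Z] by simp
  show ?int
  proof (rule Bochner_Integration.integrable_bound[OF int_g])
    show "AE \<omega> in M. norm ((\<Sum>i\<in>J. \<bar>u i\<bar> + \<bar>Z i \<omega>\<bar>) ^ p) \<le> norm (?g \<omega>)"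
    proof (rule AE_I2)
      fix \<omega>
      have "0 \<le> (\<Sum>i\<in>J. \<bar>u i\<bar> + \<bar>Z i \<omega>\<bar>) ^ p" by (simp add: sum_nonneg)
      with g[of \<omega>] show "norm ((\<Sum>i\<in>J. \<bar>u i\<bar> + \<bar>Z i \<omega>\<bar>) ^ p) \<le> norm (?g \<omega>)"
        unfolding real_norm_def by linarith
    qed
  qed measurable
  then have "(\<integral>\<omega>. (\<Sum>i\<in>J. \<bar>u i\<bar> + \<bar>Z i \<omega>\<bar>) ^ p \<partial>M) \<le> (\<integral>\<omega>. ?g \<omega> \<partial>M)"
    using int_g g by (intro integral_mono)
  also have "\<dots> = real (card J) ^ p *
      (\<Sum>i\<in>J. 2 ^ p * (\<bar>u i\<bar> ^ p * measure M (space M) + \<bar>\<sigma>\<bar> ^ p * (\<integral>z. \<bar>z\<bar> ^ p \<partial>std_normal_distribution)))"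
    using scaled_normal.integrable_abs_power[OF Z] scaled_normal.integral_abs_power[OF Z]
    by (simp add: mult.commute)
  finally show ?le .
qed

lemma smooth_imp_continuous:
  assumes "smooth f" shows "continuous_on UNIV f"
proof -
  have "f field_differentiable at y" for y
    using assms[unfolded smooth_def, rule_format, of 0 y] by simp
  then show ?thesis
    by (simp add: continuous_at_imp_continuous_on field_differentiable_imp_continuous_at)
qed

section \<open>One-particle laws and the normalized product\<close>

locale flow = white_noise_space M F W
  for M :: "'a measure" and F W +
  fixes \<phi> :: "real \<Rightarrow> real" and x :: "real \<Rightarrow> real \<Rightarrow> 'a \<Rightarrow> real"
  assumes measurable_\<phi> [measurable]: "\<phi> \<in> borel_measurable borel"
    and integral_\<phi>: "(\<integral>q. (\<phi> q)\<^sup>2 \<partial>lborel) = 1"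
    and stochastic_flow: "stochastic_flow M F W \<phi> x"
begin

lemma measurable_x [measurable]: "0 \<le> t \<Longrightarrow> x u t \<in> borel_measurable M"
  using stochastic_flow measurable_F_M unfolding stochastic_flow_def by blast

lemma nn_integral_\<phi>: "(\<integral>\<^sup>+q. ennreal ((\<phi> (c - q))\<^sup>2) \<partial>lborel) = 1"
proof -
  \<comment> \<open>A non-integrable function has integral 0, so the value 1 carries integrability
    with it.\<close>
  have "integrable lborel (\<lambda>q. (\<phi> q)\<^sup>2)"
    using integral_\<phi> not_integrable_integral_eq[of lborel "\<lambda>q. (\<phi> q)\<^sup>2"] by fastforce
  then have "(\<integral>\<^sup>+q. ennreal ((\<phi> q)\<^sup>2) \<partial>lborel) = 1"
    using integral_\<phi> by (simp add: nn_integral_eq_integral)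
  then show ?thesis
    using nn_integral_real_affine[of "\<lambda>q. ennreal ((\<phi> q)\<^sup>2)" "-1" c] by simp
qed

text \<open>At each time the reflected translate of phi^2 has integral 1, wherever the path
  \<open>y\<close> is. So the quadratic variation is the deterministic clock
  \<open>t\<close>.\<close>

lemma nn_integral_noise_kernel:
  assumes "(\<lambda>(q, s). \<phi> (y s - q)) \<in> borel_measurable (slab t)" and "0 \<le> t"
  shows "(\<integral>\<^sup>+(q, s). ennreal ((\<phi> (y s - q))\<^sup>2) \<partial>slab t) = ennreal t"
proof -
  let ?h = "\<lambda>p. ennreal ((\<phi> (y (snd p) - fst p))\<^sup>2) * indicator (UNIV \<times> {0..t}) p"
  have [measurable]: "(\<lambda>p. \<phi> (y (snd p) - fst p)) \<in> borel_measurable (slab t)"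
    using assms(1) by (simp add: case_prod_beta')
  have "(\<lambda>p. ennreal ((\<phi> (y (snd p) - fst p))\<^sup>2)) \<in> borel_measurable (slab t)" by measurable
  then have h: "?h \<in> borel_measurable (lborel \<Otimes>\<^sub>M lborel)"
    using sets_slab[of t] by (subst (asm) borel_measurable_restrict_space_iff_ennreal) (auto simp: lborel_prod)
  have "(\<integral>\<^sup>+(q, s). ennreal ((\<phi> (y s - q))\<^sup>2) \<partial>slab t) = (\<integral>\<^sup>+p. ?h p \<partial>(lborel \<Otimes>\<^sub>M lborel))"
    using sets_slab[of t] by (subst nn_integral_restrict_space) (auto simp: case_prod_beta lborel_prod)
  also have "\<dots> = (\<integral>\<^sup>+s. (\<integral>\<^sup>+q. ?h (q, s) \<partial>lborel) \<partial>lborel)"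
    by (rule lborel_pair.nn_integral_snd[OF h, symmetric])
  also have "\<dots> = (\<integral>\<^sup>+s. indicator {0..t} s \<partial>lborel)"
  proof (rule nn_integral_cong)
    fix s
    have "(\<integral>\<^sup>+q. ?h (q, s) \<partial>lborel) = (\<integral>\<^sup>+q. indicator {0..t} s * ennreal ((\<phi> (y s - q))\<^sup>2) \<partial>lborel)"
      by (intro nn_integral_cong) (auto simp: indicator_def)
    also have "\<dots> = indicator {0..t} s * (\<integral>\<^sup>+q. ennreal ((\<phi> (y s - q))\<^sup>2) \<partial>lborel)"
      by (rule nn_integral_cmult) measurable
    finally show "(\<integral>\<^sup>+q. ?h (q, s) \<partial>lborel) = indicator {0..t} s" by (simp add: nn_integral_\<phi>)
  qed
  also have "\<dots> = ennreal t" using assms(2) by simp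
  finally show ?thesis .
qed

lemma scaled_normal_x:
  assumes "0 \<le> t" shows "scaled_normal M (\<lambda>\<omega>. x u t \<omega> - u) (sqrt t)"
proof -
  from stochastic_flow assms obtain I
    where I: "has_stochastic_integral M F W t (\<lambda>(\<omega>, q, s). \<phi> (x u s \<omega> - q)) I"
      and eq: "AE \<omega> in M. x u t \<omega> = u + I \<omega>"
    unfolding stochastic_flow_def by blast
  have "scaled_normal M I (sqrt t)"
    using I assms
  proof (rule has_stochastic_integral_normal)
    fix \<omega> assume "\<omega> \<in> space M"
    have "(\<lambda>(\<omega>, q, s). \<phi> (x u s \<omega> - q)) \<in> borel_measurable (M \<Otimes>\<^sub>M slab t)"
      using I by (simp add: has_stochastic_integral_def Let_def)
    from measurable_compose[OF measurable_Pair1'[OF \<open>\<omega> \<in> space M\<close>] this]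
    have "(\<lambda>(q, s). \<phi> (x u s \<omega> - q)) \<in> borel_measurable (slab t)"
      by (simp add: case_prod_beta')
    from nn_integral_noise_kernel[OF this assms]
    show "(\<integral>\<^sup>+p. ennreal ((case (\<omega>, p) of (\<omega>, q, s) \<Rightarrow> \<phi> (x u s \<omega> - q))\<^sup>2) \<partial>slab t) = ennreal t"
      by (simp add: case_prod_beta')
  qed
  then have [measurable]: "I \<in> borel_measurable M" and d: "distr M borel I = distr std_normal_distribution borel (\<lambda>z. sqrt t * z)"
    by (simp_all add: scaled_normal_def)
  have "distr M borel (\<lambda>\<omega>. x u t \<omega> - u) = distr M borel I"
    using eq assms by (intro distr_cong_AE) auto
  then show ?thesis using d assms by (simp add: scaled_normal_def)
qed

lemma integrable_x: "0 \<le> t \<Longrightarrow> integrable M (x u t)"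
  using scaled_normal.integrable_power[OF scaled_normal_x[of t u], of 1]
    Bochner_Integration.integrable_add[of M "\<lambda>\<omega>. x u t \<omega> - u" "\<lambda>_. u"] by simp

lemma integral_x: "0 \<le> t \<Longrightarrow> (\<integral>\<omega>. x u t \<omega> \<partial>M) = u"
  using scaled_normal.integral_X[OF scaled_normal_x[of t u]] integrable_x[of t u] by (simp add: prob_space)

text \<open>The particles never cross, so \<open>x u t - x v t\<close> has a constant sign and its \<open>L\<^sup>1\<close> norm is
  given by the martingale property.\<close>

lemma integral_abs_x_diff:
  assumes "0 \<le> t" shows "(\<integral>\<omega>. \<bar>x u t \<omega> - x v t \<omega>\<bar> \<partial>M) = \<bar>u - v\<bar>"
proof -
  have *: "(\<integral>\<omega>. \<bar>x u t \<omega> - x v t \<omega>\<bar> \<partial>M) = u - v" if "v \<le> u" for u v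
  proof -
    have "AE \<omega> in M. strict_mono (\<lambda>u. x u t \<omega>)"
      using stochastic_flow assms unfolding stochastic_flow_def increasing_diffeo_def by auto
    then have "AE \<omega> in M. \<bar>x u t \<omega> - x v t \<omega>\<bar> = x u t \<omega> - x v t \<omega>"
    proof eventually_elim
      case (elim \<omega>)
      then show ?case using strict_mono_less_eq[OF elim, of v u] that by simp
    qed
    then have "(\<integral>\<omega>. \<bar>x u t \<omega> - x v t \<omega>\<bar> \<partial>M) = (\<integral>\<omega>. x u t \<omega> - x v t \<omega> \<partial>M)"
      using assms by (intro integral_cong_AE) auto
    also have "\<dots> = u - v" using assms by (simp add: integrable_x integral_x)
    finally show ?thesis .
  qed
  show ?thesis using *[of v u] *[of u v] by (cases "v \<le> u") (auto simp: abs_minus_commute)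
qed

lemma integrable_prod_x:
  assumes "0 \<le> t" "finite J"
  shows "integrable M (\<lambda>\<omega>. \<Prod>i\<in>J. x (u i) t \<omega>)"
proof (cases "J = {}")
  case False
  let ?s = "\<lambda>\<omega>. \<Sum>i\<in>J. \<bar>u i\<bar> + \<bar>x (u i) t \<omega> - u i\<bar>"
  show ?thesis
  proof (rule Bochner_Integration.integrable_bound)
    show "integrable M (\<lambda>\<omega>. ?s \<omega> ^ card J)"
      by (rule scaled_normal_moment_bound(1)[where Z="\<lambda>i \<omega>. x (u i) t \<omega> - u i", OF assms(2) False
            scaled_normal_x[OF assms(1)] finite_measure_axioms])
    show "(\<lambda>\<omega>. \<Prod>i\<in>J. x (u i) t \<omega>) \<in> borel_measurable M" using assms by measurable
    have "\<bar>x (u i) t \<omega>\<bar> \<le> ?s \<omega>" if "i \<in> J" for i \<omega>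
    proof -
      have "\<bar>x (u i) t \<omega>\<bar> \<le> \<bar>u i\<bar> + \<bar>x (u i) t \<omega> - u i\<bar>" by linarith
      also have "\<dots> \<le> ?s \<omega>" using that assms by (intro member_le_sum) auto
      finally show ?thesis .
    qed
    then have "\<bar>\<Prod>i\<in>J. x (u i) t \<omega>\<bar> \<le> ?s \<omega> ^ card J" for \<omega>
      using assms by (intro abs_prod_le_power)
    then show "AE \<omega> in M. norm (\<Prod>i\<in>J. x (u i) t \<omega>) \<le> norm (?s \<omega> ^ card J)"
      by (intro AE_I2) (simp add: order_trans[OF _ abs_ge_self])
  qed
qed simp

text \<open>The particles are compared with the single variable \<open>Z i0\<close>, which is
  exactly standard normal. The error splits into \<open>\<theta> * (D / r)\<close> and
  \<open>2 * k / \<theta> * B\<close>; with r = theta^2 both are of order 1 / theta, hence the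
  fourth root. From time 1 on, r >= 1, so rescaling does not enlarge the starting points and
  \<open>B\<close> is free of \<open>t\<close>.\<close>

lemma moment_rate:
  assumes J: "finite J" "J \<noteq> {}"
  shows "\<exists>C. \<forall>t\<ge>1. \<bar>(\<integral>\<omega>. (\<Prod>i\<in>J. x (u i) t \<omega>) \<partial>M) / sqrt t ^ card J - (\<integral>z. z ^ card J \<partial>std_normal_distribution)\<bar>
    \<le> C / sqrt (sqrt t)"
proof -
  obtain i0 where i0: "i0 \<in> J" using J by blast
  define k where "k = card J"
  define m where "m = k - 1"
  \<comment> \<open>\<open>Z i0\<close> is centred while the \<open>z i\<close> are not: the shift
    \<open>u i0 / r\<close> accounts for the second summand.\<close>
  define D where "D = (\<Sum>i\<in>J. \<bar>u i - u i0\<bar> + \<bar>u i0\<bar>)"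
  \<comment> \<open>The order \<open>2 * m + 1\<close> arises from the square of
    \<open>s ^ m\<close> and one more factor \<open>s\<close> bounding \<open>\<delta>\<close>;
    \<open>\<bar>1\<bar>\<close> is the deviation of the normalized variables.\<close>
  define B where "B = real k ^ (2 * m + 1) * (\<Sum>i\<in>J. 2 ^ (2 * m + 1) *
    (\<bar>u i\<bar> ^ (2 * m + 1) + \<bar>1\<bar> ^ (2 * m + 1) * (\<integral>z. \<bar>z\<bar> ^ (2 * m + 1) \<partial>std_normal_distribution)))"
  have "\<bar>(\<integral>\<omega>. (\<Prod>i\<in>J. x (u i) t \<omega>) \<partial>M) / sqrt t ^ k - (\<integral>z. z ^ k \<partial>std_normal_distribution)\<bar>
    \<le> (D + 2 * k * B) / sqrt (sqrt t)" if "1 \<le> t" for t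
  proof -
    define r where "r = sqrt t"
    define \<theta> where "\<theta> = sqrt r"
    have r: "1 \<le> r" "r = \<theta> * \<theta>" and \<theta>: "0 < \<theta>" using that by (auto simp: r_def \<theta>_def)
    have [simp]: "0 \<le> t" using that by simp
    define Z where "Z i \<omega> = (x (u i) t \<omega> - u i) / r" for i \<omega>
    define z where "z i \<omega> = x (u i) t \<omega> / r" for i \<omega>
    define s where "s \<omega> = (\<Sum>i\<in>J. \<bar>u i\<bar> + \<bar>Z i \<omega>\<bar>)" for \<omega>
    define \<delta> where "\<delta> \<omega> = (\<Sum>i\<in>J. \<bar>z i \<omega> - Z i0 \<omega>\<bar>)" for \<omega>
    have Z: "scaled_normal M (Z i) 1" for i
      unfolding Z_def[abs_def] r_def using that by (intro scaled_normal.normalized scaled_normal_x) auto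
    have [measurable]: "Z i \<in> borel_measurable M" "z i \<in> borel_measurable M" for i
      unfolding Z_def[abs_def] z_def[abs_def] by measurable
    have [measurable]: "s \<in> borel_measurable M" "\<delta> \<in> borel_measurable M"
      unfolding s_def[abs_def] \<delta>_def[abs_def] by measurable
    have s_ge: "\<bar>u i\<bar> + \<bar>Z i \<omega>\<bar> \<le> s \<omega>" if "i \<in> J" for i \<omega>
      unfolding s_def using that J by (intro member_le_sum) auto
    have z_le: "\<bar>z i \<omega>\<bar> \<le> s \<omega>" if "i \<in> J" for i \<omega>
    proof -
      have "z i \<omega> = u i / r + Z i \<omega>" by (simp add: z_def Z_def diff_divide_distrib)
      moreover have "\<bar>u i / r\<bar> \<le> \<bar>u i\<bar>"
        using r(1) divide_left_mono[of 1 r "\<bar>u i\<bar>"] by (simp add: abs_divide)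
      ultimately show ?thesis using s_ge[OF that, of \<omega>] by linarith
    qed
    have Z_le: "\<bar>Z i0 \<omega>\<bar> \<le> s \<omega>" for \<omega> using s_ge[OF i0, of \<omega>] by linarith
    have s0: "0 \<le> s \<omega>" for \<omega> using Z_le[of \<omega>] by linarith
    have \<delta>0: "0 \<le> \<delta> \<omega>" for \<omega> unfolding \<delta>_def by (simp add: sum_nonneg)
    have \<delta>_le: "\<delta> \<omega> \<le> 2 * k * s \<omega>" for \<omega>
    proof -
      have "\<delta> \<omega> \<le> real (card J) * (2 * s \<omega>)"
        unfolding \<delta>_def
      proof (rule sum_bounded_above)
        fix i assume "i \<in> J"
        then show "\<bar>z i \<omega> - Z i0 \<omega>\<bar> \<le> 2 * s \<omega>" using z_le[of i \<omega>] Z_le[of \<omega>] by linarith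
      qed
      then show ?thesis by (simp add: k_def mult_ac)
    qed
    have pointwise: "\<bar>(\<Prod>i\<in>J. z i \<omega>) - Z i0 \<omega> ^ k\<bar> \<le> \<theta> * \<delta> \<omega> + 2 * k / \<theta> * s \<omega> ^ (2 * m + 1)" for \<omega>
    proof -
      have "\<bar>(\<Prod>i\<in>J. z i \<omega>) - Z i0 \<omega> ^ k\<bar> \<le> \<delta> \<omega> * s \<omega> ^ m"
        unfolding \<delta>_def k_def m_def using J z_le Z_le by (intro prod_minus_power_bound)
      \<comment> \<open>\<open>\<delta>\<close> is small only in \<open>L\<^sup>1\<close>; the weight \<open>\<theta> = t powr (1/4)\<close> balances it against the moments of \<open>s\<close>.\<close>
      also have "\<dots> \<le> \<delta> \<omega> * (\<theta> + s \<omega> ^ (2 * m) / \<theta>)"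
      proof (intro mult_left_mono \<delta>0)
        show "s \<omega> ^ m \<le> \<theta> + s \<omega> ^ (2 * m) / \<theta>"
          using le_add_square_divide[OF \<theta>, of "s \<omega> ^ m"] by (simp only: power_even_eq)
      qed
      also have "\<dots> = \<theta> * \<delta> \<omega> + \<delta> \<omega> * (s \<omega> ^ (2 * m) / \<theta>)" by (simp add: algebra_simps)
      also have "\<dots> \<le> \<theta> * \<delta> \<omega> + (2 * k * s \<omega>) * (s \<omega> ^ (2 * m) / \<theta>)"
        using \<theta> s0[of \<omega>] by (intro add_left_mono mult_right_mono \<delta>_le) auto
      finally show ?thesis by (simp add: mult_ac)
    qed
    have diff: "integrable M (\<lambda>\<omega>. \<bar>z i \<omega> - Z i0 \<omega>\<bar>)"
      "(\<integral>\<omega>. \<bar>z i \<omega> - Z i0 \<omega>\<bar> \<partial>M) \<le> (\<bar>u i - u i0\<bar> + \<bar>u i0\<bar>) / r" for i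
    proof -
      have eq: "z i \<omega> - Z i0 \<omega> = (x (u i) t \<omega> - x (u i0) t \<omega> + u i0) / r" for \<omega>
        by (simp add: z_def Z_def flip: diff_divide_distrib)
      show int: "integrable M (\<lambda>\<omega>. \<bar>z i \<omega> - Z i0 \<omega>\<bar>)"
        unfolding eq by (intro integrable_abs integrable_divide Bochner_Integration.integrable_add
            Bochner_Integration.integrable_diff integrable_x) auto
      have int': "integrable M (\<lambda>\<omega>. \<bar>x (u i) t \<omega> - x (u i0) t \<omega>\<bar>)"
        by (intro integrable_abs Bochner_Integration.integrable_diff integrable_x) auto
      have "(\<integral>\<omega>. \<bar>z i \<omega> - Z i0 \<omega>\<bar> \<partial>M) \<le> (\<integral>\<omega>. (\<bar>x (u i) t \<omega> - x (u i0) t \<omega>\<bar> + \<bar>u i0\<bar>) / r \<partial>M)"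
        using int int' r(1) by (intro integral_mono) (auto simp: eq abs_divide intro!: divide_right_mono)
      also have "\<dots> = (\<bar>u i - u i0\<bar> + \<bar>u i0\<bar>) / r"
        using int' by (simp add: integral_abs_x_diff prob_space)
      finally show "(\<integral>\<omega>. \<bar>z i \<omega> - Z i0 \<omega>\<bar> \<partial>M) \<le> (\<bar>u i - u i0\<bar> + \<bar>u i0\<bar>) / r" .
    qed
    have int_\<delta>: "integrable M \<delta>" unfolding \<delta>_def[abs_def] by (intro Bochner_Integration.integrable_sum diff)
    have E_\<delta>: "(\<integral>\<omega>. \<delta> \<omega> \<partial>M) \<le> D / r"
      unfolding \<delta>_def D_def sum_divide_distrib using diff by (simp add: sum_mono)
    have int_s: "integrable M (\<lambda>\<omega>. s \<omega> ^ (2 * m + 1))" and E_s: "(\<integral>\<omega>. s \<omega> ^ (2 * m + 1) \<partial>M) \<le> B"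
      unfolding s_def B_def k_def using scaled_normal_moment_bound[OF J Z finite_measure_axioms, where u=u and p="2 * m + 1"] by (simp_all add: prob_space)
    have int_prod: "integrable M (\<lambda>\<omega>. \<Prod>i\<in>J. z i \<omega>)"
      unfolding z_def prod_dividef using integrable_prod_x[OF \<open>0 \<le> t\<close> J(1)] by simp
    have "(\<integral>\<omega>. (\<Prod>i\<in>J. x (u i) t \<omega>) \<partial>M) / sqrt t ^ k = (\<integral>\<omega>. (\<Prod>i\<in>J. z i \<omega>) \<partial>M)"
      by (simp add: z_def prod_dividef r_def k_def)
    moreover have "(\<integral>z. z ^ k \<partial>std_normal_distribution) = (\<integral>\<omega>. Z i0 \<omega> ^ k \<partial>M)"
      using scaled_normal.integral_power[OF Z, of i0 k] by simp
    ultimately have "\<bar>(\<integral>\<omega>. (\<Prod>i\<in>J. x (u i) t \<omega>) \<partial>M) / sqrt t ^ k - (\<integral>z. z ^ k \<partial>std_normal_distribution)\<bar>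
      = norm (\<integral>\<omega>. (\<Prod>i\<in>J. z i \<omega>) - Z i0 \<omega> ^ k \<partial>M)"
      using int_prod scaled_normal.integrable_power[OF Z, of i0 k] by simp
    also have "\<dots> \<le> (\<integral>\<omega>. \<theta> * \<delta> \<omega> + 2 * k / \<theta> * s \<omega> ^ (2 * m + 1) \<partial>M)"
    proof (rule integral_norm_le_integral)
      show "integrable M (\<lambda>\<omega>. (\<Prod>i\<in>J. z i \<omega>) - Z i0 \<omega> ^ k)"
        by (rule Bochner_Integration.integrable_diff[OF int_prod scaled_normal.integrable_power[OF Z]])
      show "integrable M (\<lambda>\<omega>. \<theta> * \<delta> \<omega> + 2 * k / \<theta> * s \<omega> ^ (2 * m + 1))"
        by (rule Bochner_Integration.integrable_add[OF integrable_mult_right[OF int_\<delta>] integrable_mult_right[OF int_s]])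
    qed (simp only: real_norm_def pointwise)
    also have "\<dots> = \<theta> * (\<integral>\<omega>. \<delta> \<omega> \<partial>M) + 2 * k / \<theta> * (\<integral>\<omega>. s \<omega> ^ (2 * m + 1) \<partial>M)"
      using int_\<delta> int_s by (simp only: Bochner_Integration.integral_add integrable_mult_right integral_mult_right_zero)
    also have "\<dots> \<le> \<theta> * (D / r) + 2 * k / \<theta> * B"
      using \<theta> E_\<delta> E_s by (intro add_mono mult_left_mono) auto
    also have "\<dots> = (D + 2 * k * B) / \<theta>" using \<theta> r(2) by (simp add: field_simps)
    finally show ?thesis by (simp only: \<theta>_def r_def)
  qed
  then show ?thesis unfolding k_def by blast
qed

lemma moment_limit:
  assumes "finite J" "J \<noteq> {}"
  shows "((\<lambda>t. (\<integral>\<omega>. (\<Prod>i\<in>J. x (u i) t \<omega>) \<partial>M) / sqrt t ^ card J)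
    \<longlongrightarrow> (\<integral>z. z ^ card J \<partial>std_normal_distribution)) at_top"
proof -
  obtain C where C: "\<And>t. 1 \<le> t \<Longrightarrow> \<bar>(\<integral>\<omega>. (\<Prod>i\<in>J. x (u i) t \<omega>) \<partial>M) / sqrt t ^ card J -
      (\<integral>z. z ^ card J \<partial>std_normal_distribution)\<bar> \<le> C / sqrt (sqrt t)"
    using moment_rate[OF assms] by blast
  have "((\<lambda>t. C / sqrt (sqrt t)) \<longlongrightarrow> 0) at_top"
    by (intro tendsto_divide_0[OF tendsto_const] filterlim_at_top_imp_at_infinity
        filterlim_compose[OF sqrt_at_top filterlim_compose[OF sqrt_at_top]] filterlim_ident)
  then have "((\<lambda>t. (\<integral>\<omega>. (\<Prod>i\<in>J. x (u i) t \<omega>) \<partial>M) / sqrt t ^ card J -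
      (\<integral>z. z ^ card J \<partial>std_normal_distribution)) \<longlongrightarrow> 0) at_top"
    by (rule Lim_null_comparison[rotated]) (use C in \<open>auto intro!: eventually_at_top_linorderI[of 1]\<close>)
  then show ?thesis by (simp add: LIM_zero_iff)
qed

end

text \<open>The left side is the 2n-th standard normal moment. In the induction step (2n + 2)(2n +
  1) is divided by 2 (n + 1), which leaves the next odd factor.\<close>

lemma double_factorial_eq:
  "fact (2 * n) / (2 ^ n * fact n) = (\<Prod>k=1..n. 2 * real k - 1)"
proof (induction n)
  case (Suc n)
  have cancel: "(2 * N * c * f) / (2 * p * (N * g)) = c * (f / (p * g))" if "N \<noteq> 0" for N c f p g :: real
    using that by (simp add: divide_simps)
  have "fact (2 * Suc n) = 2 * real (Suc n) * (2 * real (Suc n) - 1) * fact (2 * n)"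
    by (simp add: algebra_simps)
  then have "fact (2 * Suc n) / (2 ^ Suc n * fact (Suc n)) = (2 * real (Suc n) - 1) * (fact (2 * n) / (2 ^ n * fact n))"
    by (simp only: fact_Suc power_Suc cancel[OF of_nat_neq_0])
  then show ?case using Suc.IH by simp
qed simp

text \<open>Integrability accompanies each limit because a non-integrable product would have
  integral 0 by default; with it, the integrals are genuine expectations.\<close>

theorem theorem3p3:
  fixes M :: "'a measure"
    and F :: "real \<Rightarrow> 'a measure"
    and W :: "(real \<times> real) set \<Rightarrow> 'a \<Rightarrow> real"
    and \<phi> :: "real \<Rightarrow> real"
    and x :: "real \<Rightarrow> real \<Rightarrow> 'a \<Rightarrow> real"
  assumes "prob_space M"
    and "white_noise M W"
    and "noise_filtration M W F"
    and "smooth \<phi>"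
    and "compact (closure {q. \<phi> q \<noteq> 0})"
    and "\<And>q. \<phi> q \<ge> 0"
    and "\<And>q. \<phi> (- q) = \<phi> q"
    and "(\<integral>q. (\<phi> q)\<^sup>2 \<partial>lborel) = 1"
    and "stochastic_flow M F W \<phi> x"
  shows "(\<forall>n\<ge>1. \<forall>u :: nat \<Rightarrow> real.
            (\<forall>t\<ge>0. integrable M (\<lambda>\<omega>. \<Prod>i=1..2*n-1. x (u i) t \<omega>)) \<and>
            ((\<lambda>t. 1 / t powr (real n - 1/2) * (\<integral>\<omega>. (\<Prod>i=1..2*n-1. x (u i) t \<omega>) \<partial>M))
               \<longlongrightarrow> 0) at_top) \<and>
         (\<forall>n\<ge>1. \<forall>u :: nat \<Rightarrow> real.
            (\<forall>t\<ge>0. integrable M (\<lambda>\<omega>. \<Prod>i=1..2*n. x (u i) t \<omega>)) \<and>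
            ((\<lambda>t. 1 / t ^ n * (\<integral>\<omega>. (\<Prod>i=1..2*n. x (u i) t \<omega>) \<partial>M))
               \<longlongrightarrow> (\<Prod>k=1..n. 2 * real k - 1)) at_top)"
proof -
  have "\<phi> \<in> borel_measurable borel"
    by (rule borel_measurable_continuous_onI[OF smooth_imp_continuous[OF assms(4)]])
  with assms interpret flow M F W \<phi> x
    by (simp add: flow_def flow_axioms_def white_noise_space_def white_noise_space_axioms_def)
  show ?thesis
  proof (intro conjI allI impI)
    fix n :: nat and u :: "nat \<Rightarrow> real" assume n: "1 \<le> n"
    have "odd (2 * n - 1)" using n by simp
    then have zero: "(\<integral>z. z ^ (2 * n - 1) \<partial>std_normal_distribution) = 0"
      by (rule integral_std_normal_distribution_moment_odd)
    have "((\<lambda>t. (\<integral>\<omega>. (\<Prod>i=1..2*n-1. x (u i) t \<omega>) \<partial>M) / sqrt t ^ (2 * n - 1)) \<longlongrightarrow> 0) at_top"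
      using moment_limit[of "{1..2*n-1}" u] n zero by simp
    moreover have "\<forall>\<^sub>F t in at_top. (\<integral>\<omega>. (\<Prod>i=1..2*n-1. x (u i) t \<omega>) \<partial>M) / sqrt t ^ (2 * n - 1)
        = 1 / t powr (real n - 1/2) * (\<integral>\<omega>. (\<Prod>i=1..2*n-1. x (u i) t \<omega>) \<partial>M)"
    proof (rule eventually_at_top_linorderI[of 1])
      fix t :: real assume "1 \<le> t"
      \<comment> \<open>n - 1/2 is half of 2n - 1, and \<open>1 \<le> n\<close> keeps the natural
        subtraction exact.\<close>
      have "t powr (real n - 1/2) = (t powr (1/2)) powr real (2 * n - 1)"
        using n by (simp add: powr_powr of_nat_diff diff_divide_distrib)
      also have "\<dots> = sqrt t ^ (2 * n - 1)"
        using \<open>1 \<le> t\<close> by (simp add: powr_half_sqrt powr_realpow)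
      finally show "(\<integral>\<omega>. (\<Prod>i=1..2*n-1. x (u i) t \<omega>) \<partial>M) / sqrt t ^ (2 * n - 1)
        = 1 / t powr (real n - 1/2) * (\<integral>\<omega>. (\<Prod>i=1..2*n-1. x (u i) t \<omega>) \<partial>M)" by simp
    qed
    ultimately show "((\<lambda>t. 1 / t powr (real n - 1/2) * (\<integral>\<omega>. (\<Prod>i=1..2*n-1. x (u i) t \<omega>) \<partial>M)) \<longlongrightarrow> 0) at_top"
      by (rule Lim_transform_eventually)
  next
    fix n :: nat and u :: "nat \<Rightarrow> real" assume n: "1 \<le> n"
    have "((\<lambda>t. (\<integral>\<omega>. (\<Prod>i=1..2*n. x (u i) t \<omega>) \<partial>M) / sqrt t ^ (2 * n))
        \<longlongrightarrow> (\<Prod>k=1..n. 2 * real k - 1)) at_top"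
      using moment_limit[of "{1..2*n}" u] n
      by (simp add: std_normal_distribution_even_moments(1) double_factorial_eq)
    moreover have "\<forall>\<^sub>F t in at_top. (\<integral>\<omega>. (\<Prod>i=1..2*n. x (u i) t \<omega>) \<partial>M) / sqrt t ^ (2 * n)
        = 1 / t ^ n * (\<integral>\<omega>. (\<Prod>i=1..2*n. x (u i) t \<omega>) \<partial>M)"
      by (rule eventually_at_top_linorderI[of 1]) (simp add: power_mult)
    ultimately show "((\<lambda>t. 1 / t ^ n * (\<integral>\<omega>. (\<Prod>i=1..2*n. x (u i) t \<omega>) \<partial>M))
        \<longlongrightarrow> (\<Prod>k=1..n. 2 * real k - 1)) at_top"
      by (rule Lim_transform_eventually)
  qed (auto intro: integrable_prod_x)
qed

end
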